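(* Let $G$ be a finite simple graph on $n$ vertices with $\alpha=\alpha(G)$. Then the $h$-polynomial of $R/J(G)$ is $$h_{R/J(G)}(t)=\sum_{k=0}^{n-\alpha-1}(k+1)t^k+\sum_{s=-1}^{\alpha-3}E_{s+3}\,t^{n-s-3},$$ where, for $-1\le s\le \alpha-3$, $$E_{s+3}=(n-s-2)-\sum_{j=s+3}^{\alpha}\binom{j-2}{s+1}(-1)^{j-s-1}g_j .$$
   Context: $\Bbbk$ is a field and $R=\Bbbk[x_1,\dots,x_n]$ with the standard grading, the variables being indexed by the vertices $1,\dots,n$ of $G$. $\alpha(G)$ is the independence number of $G$, and $g_j$ is the number of independent sets of $G$ of size $j$. The cover ideal of $G$ is $J(G)=\bigl(\prod_{i\in C}x_i : C \text{ a minimal vertex cover of } G\bigr)=\bigcap_{\{i,j\}\in E(G)}(x_i,x_j)$. For a standard graded $\Bbbk$-algebra $A=\bigoplus_{d\ge0}A_d$ with Hilbert series $H_A(t)=\sum_{d\ge 0}(\dim_{\Bbbk}A_d)t^d$, the $h$-polynomial $h_A(t)\in\mathbb{Z}[t]$ is the unique polynomial with $H_A(t)=h_A(t)/(1-t)^{\dim A}$. *)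

theory Defs
  imports
    "HOL-Library.Poly_Mapping"
    "HOL-Library.Extended_Nat"
    "HOL-Algebra.QuotRing"
    "HOL-Algebra.Embedded_Algebras"
    "HOL-Computational_Algebra.Polynomial_FPS"
begin

section \<open>Finite simple graphs\<close>

definition simple_graph :: "'v set \<Rightarrow> 'v set set \<Rightarrow> bool" where
  "simple_graph V E \<longleftrightarrow> finite V \<and> (\<forall>e\<in>E. e \<subseteq> V \<and> card e = 2)"

definition independent_sets :: "'v set \<Rightarrow> 'v set set \<Rightarrow> 'v set set" where
  "independent_sets V E = {S. S \<subseteq> V \<and> (\<forall>e\<in>E. \<not> e \<subseteq> S)}"

definition independence_number :: "'v set \<Rightarrow> 'v set set \<Rightarrow> nat" where
  "independence_number V E = Max (card ` independent_sets V E)"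

definition num_independent_sets :: "'v set \<Rightarrow> 'v set set \<Rightarrow> nat \<Rightarrow> nat" where
  "num_independent_sets V E j = card {S \<in> independent_sets V E. card S = j}"

definition vertex_cover :: "'v set \<Rightarrow> 'v set set \<Rightarrow> 'v set \<Rightarrow> bool" where
  "vertex_cover V E C \<longleftrightarrow> C \<subseteq> V \<and> (\<forall>e\<in>E. e \<inter> C \<noteq> {})"

definition minimal_vertex_cover :: "'v set \<Rightarrow> 'v set set \<Rightarrow> 'v set \<Rightarrow> bool" where
  "minimal_vertex_cover V E C \<longleftrightarrow>
     vertex_cover V E C \<and> (\<forall>C'. C' \<subset> C \<longrightarrow> \<not> vertex_cover V E C')"


section \<open>The polynomial ring with variables indexed by a set\<close>

text \<open>
  A monomial is a finitely supported exponent function, and a polynomial is a finitely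
  supported function from monomials to coefficients. The product of the type is the
  convolution product. The ring of polynomials in the variables indexed by \<open>V\<close>
  is obtained by restricting the carrier.
\<close>

type_synonym ('v, 'k) mpoly = "('v \<Rightarrow>\<^sub>0 nat) \<Rightarrow>\<^sub>0 'k"

definition poly_ring :: "'v set \<Rightarrow> ('v, 'k::field) mpoly ring" where
  "poly_ring V =
     \<lparr>carrier = {p. \<forall>m \<in> Poly_Mapping.keys p. Poly_Mapping.keys m \<subseteq> V},
      monoid.mult = (*), one = 1, zero = 0, add = (+)\<rparr>"

definition pvar :: "'v \<Rightarrow> ('v, 'k::field) mpoly" where
  "pvar i = Poly_Mapping.single (Poly_Mapping.single i 1) 1"

definition mon_degree :: "('v \<Rightarrow>\<^sub>0 nat) \<Rightarrow> nat" where
  "mon_degree m = (\<Sum>i \<in> Poly_Mapping.keys m. Poly_Mapping.lookup m i)"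

definition poly_constants :: "('v, 'k::field) mpoly set" where
  "poly_constants = range (Poly_Mapping.single 0)"

definition poly_component :: "'v set \<Rightarrow> nat \<Rightarrow> ('v, 'k::field) mpoly set" where
  "poly_component V d =
     {p \<in> carrier (poly_ring V). \<forall>m \<in> Poly_Mapping.keys p. mon_degree m = d}"


section \<open>Krull dimension, Hilbert series and h-polynomial\<close>

text \<open>
  With this definition the zero ring has dimension \<open>0\<close> (there are no primes, so the
  supremum is empty). The choice does not affect the h-polynomial of the zero ring,
  whose Hilbert series vanishes.
\<close>

definition krull_dim :: "('a, 'b) ring_scheme \<Rightarrow> enat" where
  "krull_dim A =
     Sup {enat l | l. \<exists>P :: nat \<Rightarrow> 'a set.
            (\<forall>i\<le>l. primeideal (P i) A) \<and> (\<forall>i<l. P i \<subset> P (Suc i))}"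

text \<open>
  Below, a graded algebra is given by its ring \<open>A\<close>, the image \<open>K \<subseteq> carrier A\<close> of the
  ground field, and its homogeneous components \<open>gr d \<subseteq> carrier A\<close>; \<open>ring.dim A K\<close> is
  the dimension as a vector space over \<open>K\<close>.
\<close>

definition hilbert_series :: "('a, 'b) ring_scheme \<Rightarrow> 'a set \<Rightarrow> (nat \<Rightarrow> 'a set) \<Rightarrow> int fps" where
  "hilbert_series A K gr = Abs_fps (\<lambda>d. int (ring.dim A K (gr d)))"

text \<open>
  The defining equation \<open>H = h / (1 - t) ^ dim A\<close> is stated with the denominator cleared.
\<close>

definition h_polynomial :: "('a, 'b) ring_scheme \<Rightarrow> 'a set \<Rightarrow> (nat \<Rightarrow> 'a set) \<Rightarrow> int poly" where
  "h_polynomial A K gr =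
     (THE h. fps_of_poly h = hilbert_series A K gr * (1 - fps_X) ^ the_enat (krull_dim A))"

text \<open>
  The h-polynomial of \<open>R/J\<close> for an ideal \<open>J\<close> of \<open>R = poly_ring V\<close>: the ground field
  and the grading of \<open>R/J\<close> are the images of those of \<open>R\<close> under \<open>p \<mapsto> J + p\<close>.
\<close>

definition h_polynomial_quot :: "'v set \<Rightarrow> ('v, 'k::field) mpoly set \<Rightarrow> int poly" where
  "h_polynomial_quot V J =
     h_polynomial (poly_ring V Quot J)
       ((\<lambda>p. J +>\<^bsub>poly_ring V\<^esub> p) ` poly_constants)
       (\<lambda>d. (\<lambda>p. J +>\<^bsub>poly_ring V\<^esub> p) ` poly_component V d)"


section \<open>Cover ideals\<close>

text \<open>
  If there are no edges, the only minimal vertex cover is \<open>{}\<close>, the generator is the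
  empty product \<open>1\<close>, and the cover ideal is the whole ring.
\<close>

definition cover_ideal :: "'v set \<Rightarrow> 'v set set \<Rightarrow> ('v, 'k::field) mpoly set" where
  "cover_ideal V E = Idl\<^bsub>poly_ring V\<^esub> {\<Prod>i\<in>C. pvar i | C. minimal_vertex_cover V E C}"

end

theory Submission
  imports Defs
begin

text \<open>
  The cover ideal \<open>J\<close> is the squarefree monomial ideal whose monomials are those supported on a
  vertex cover. So \<open>R/J\<close> is the Stanley--Reisner ring of the complex whose faces are the
  complements of the vertex sets that are not independent. There are
  \<open>f\<^sub>j = (n choose j) - g\<^sub>j\<close> such sets of size \<open>j\<close>, and all of them have \<open>j \<ge> 2\<close>. The
  monomials supported on no vertex cover form a basis of \<open>R/J\<close> (\<open>quotient_dimension\<close>), and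
  those with support exactly \<open>F\<close> have generating function \<open>(t / (1 - t)) ^ card F\<close>
  (\<open>full_support_series\<close>). Hence the Hilbert series is the sum of
  \<open>f\<^sub>j * (t / (1 - t)) ^ (n - j)\<close> over \<open>j \<ge> 2\<close>.

  The Krull dimension of \<open>R/J\<close> is \<open>n - 2\<close> if there is an edge (\<open>krull_dim_cover_quotient\<close>). A
  prime above \<open>J\<close> contains both variables of some edge, so the point is that a chain of primes
  has at most as many strict steps as there are variables outside the smallest prime. This
  follows from an elementary argument. Pick \<open>y\<^sub>i\<close> in \<open>P\<^sub>i\<^sub>+\<^sub>1\<close> but not in \<open>P\<^sub>i\<close>. If there are more
  steps than variables, counting monomials shows that the \<open>y\<^sub>i\<close> are algebraically dependent
  (\<open>algebraic_dependence\<close>). Removing the lowest power of \<open>y\<^sub>0\<close> from the relation, then of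
  \<open>y\<^sub>1\<close>, and so on, moves a shorter and shorter relation up the chain until a nonzero constant
  lies in a prime (\<open>no_relation_along_chain\<close>).

  Multiplying the Hilbert series by \<open>(1 - t) ^ (n - 2)\<close> gives
  \<open>h(t) = (\<Sum>j=2..n. f\<^sub>j * t ^ (n - j) * (1 - t) ^ (j - 2))\<close>. The contribution of the binomials
  \<open>n choose j\<close> is \<open>1 + 2 * t + \<dots> + (n - 1) * t ^ (n - 2)\<close> by the binomial theorem. Expanding the
  powers of \<open>1 - t\<close> in the contribution of the \<open>g\<^sub>j\<close> yields the coefficients of the theorem
  (\<open>dependent_sum_expansion\<close>). For exponents below \<open>n - \<alpha>\<close> only the first contribution
  is present, since \<open>g\<^sub>j = 0\<close> for \<open>j > \<alpha>\<close>.
\<close>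

section \<open>Polynomials and their monomials\<close>
text \<open>
  Exponent vectors and polynomials are both finitely supported functions. Separate names for
  their supports keep the two levels apart.
\<close>
abbreviation monomials :: "('v, 'k::field) mpoly \<Rightarrow> ('v \<Rightarrow>\<^sub>0 nat) set" where
  "monomials \<equiv> Poly_Mapping.keys"

abbreviation supp :: "('v \<Rightarrow>\<^sub>0 nat) \<Rightarrow> 'v set" where
  "supp \<equiv> Poly_Mapping.keys"

abbreviation coef :: "('v, 'k::field) mpoly \<Rightarrow> ('v \<Rightarrow>\<^sub>0 nat) \<Rightarrow> 'k" where
  "coef \<equiv> Poly_Mapping.lookup"

abbreviation monomial :: "('v \<Rightarrow>\<^sub>0 nat) \<Rightarrow> ('v, 'k::field) mpoly" where
  "monomial m \<equiv> Poly_Mapping.single m 1"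

abbreviation const :: "'k \<Rightarrow> ('v, 'k::field) mpoly" where
  "const \<equiv> Poly_Mapping.single 0"

lemma supp_add: "supp (m + m') = supp m \<union> supp m'"
  by (auto simp: in_keys_iff lookup_add)

lemma poly_ring_simps [simp]:
  "monoid.mult (poly_ring V) = (*)" "one (poly_ring V) = 1"
  "zero (poly_ring V) = 0" "add (poly_ring V) = (+)"
  by (simp_all add: poly_ring_def)

lemma mem_poly_ring:
  "p \<in> carrier (poly_ring V) \<longleftrightarrow> (\<forall>m\<in>monomials p. supp m \<subseteq> V)"
  by (simp add: poly_ring_def)

lemma monomials_mult:
  "m \<in> monomials (p * q) \<Longrightarrow> \<exists>a\<in>monomials p. \<exists>b\<in>monomials q. m = a + b"
  using keys_mult[of p q] by blast

lemma monomials_add: "m \<in> monomials (p + q) \<Longrightarrow> m \<in> monomials p \<or> m \<in> monomials q"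
  using keys_add[of p q] by blast

lemma monomials_uminus [simp]: "monomials (- p) = monomials p"
  by (auto simp: in_keys_iff)

lemma poly_ring_cring: "cring (poly_ring V :: ('v, 'k::field) mpoly ring)"
proof (rule cringI)
  show "abelian_group (poly_ring V :: ('v, 'k) mpoly ring)"
  proof (rule abelian_groupI, goal_cases)
    case (6 x)
    then show ?case
      by (intro bexI[of _ "- x"]) (auto simp: mem_poly_ring)
  qed (auto simp: mem_poly_ring ac_simps dest!: monomials_add)
  show "comm_monoid (poly_ring V :: ('v, 'k) mpoly ring)"
  proof (rule comm_monoidI, goal_cases)
    case (1 x y)
    then show ?case
      by (fastforce simp: mem_poly_ring supp_add dest!: monomials_mult)
  qed (auto simp: mem_poly_ring ac_simps)
qed (simp add: distrib_right)

lemma poly_ring_a_inv: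
  assumes "p \<in> carrier (poly_ring V)"
  shows "\<ominus>\<^bsub>poly_ring V\<^esub> p = - p"
proof -
  interpret cring "poly_ring V" by (rule poly_ring_cring)
  have "- p \<in> carrier (poly_ring V)" using assms by (auto simp: mem_poly_ring)
  then show ?thesis
    using minus_equality[of "- p" p] assms by simp
qed

lemma poly_ring_minus:
  assumes "p \<in> carrier (poly_ring V)" "q \<in> carrier (poly_ring V)"
  shows "p \<ominus>\<^bsub>poly_ring V\<^esub> q = p - q"
  using assms by (simp add: a_minus_def poly_ring_a_inv)

text \<open>
  Splitting a polynomial into the terms with exponent vectors in \<open>A\<close> and the others is the
  projection along which all quotients below are computed. For \<open>A\<close> the monomials free of
  certain variables it is the substitution of \<open>0\<close> for those variables.
\<close>
definition part :: "('v \<Rightarrow>\<^sub>0 nat) set \<Rightarrow> ('v, 'k::field) mpoly \<Rightarrow> ('v, 'k) mpoly" where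
  "part A p = Poly_Mapping.mapp (\<lambda>m c. c when m \<in> A) p"

lemma coef_part: "coef (part A p) m = (coef p m when m \<in> A)"
  by (auto simp: part_def lookup_mapp when_def in_keys_iff)

lemma monomials_part [simp]: "monomials (part A p) = monomials p \<inter> A"
  by (auto simp: in_keys_iff coef_part when_def split: if_splits)

lemma part_add_part_Compl: "part A p + part (- A) p = p"
  by (rule poly_mapping_eqI) (simp add: lookup_add coef_part when_def)

lemma part_in_poly_ring: "p \<in> carrier (poly_ring V) \<Longrightarrow> part A p \<in> carrier (poly_ring V)"
  by (auto simp: mem_poly_ring)

section \<open>Ideals determined by supports\<close>
text \<open>
  The squarefree monomial ideals, in the form in which membership can be tested term by term:
  the family \<open>U\<close> lists the supports of the monomials in the ideal. Both the cover ideal and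
  the primes generated by variables are of this kind.
\<close>
definition support_ideal :: "'v set \<Rightarrow> 'v set set \<Rightarrow> ('v, 'k::field) mpoly set" where
  "support_ideal V U = {p \<in> carrier (poly_ring V). \<forall>m\<in>monomials p. supp m \<in> U}"

definition up_closed :: "'v set \<Rightarrow> 'v set set \<Rightarrow> bool" where
  "up_closed V U \<longleftrightarrow> (\<forall>S T. S \<in> U \<longrightarrow> S \<subseteq> T \<longrightarrow> T \<subseteq> V \<longrightarrow> T \<in> U)"

lemma support_ideal_ideal:
  assumes "up_closed V U"
  shows "ideal (support_ideal V U :: ('v, 'k::field) mpoly set) (poly_ring V)"
proof (rule idealI)
  interpret R: cring "poly_ring V :: ('v, 'k) mpoly ring" by (rule poly_ring_cring)
  show "ring (poly_ring V :: ('v, 'k) mpoly ring)" by unfold_locales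
  show "subgroup (support_ideal V U) (add_monoid (poly_ring V :: ('v, 'k) mpoly ring))"
  proof (rule group.subgroupI[OF R.a_group], goal_cases)
    case (3 a)
    then show ?case
      using poly_ring_a_inv[of a V, unfolded a_inv_def]
      by (auto simp: support_ideal_def mem_poly_ring)
  next
    case (4 a b)
    then show ?case
      using R.a_closed[of a b] by (auto simp: support_ideal_def dest!: monomials_add)
  next
    case 2
    have "0 \<in> (support_ideal V U :: ('v, 'k) mpoly set)" by (simp add: support_ideal_def mem_poly_ring)
    then show ?case by blast
  qed (auto simp: support_ideal_def)
  fix a x :: "('v, 'k) mpoly"
  assume a: "a \<in> support_ideal V U" and x: "x \<in> carrier (poly_ring V)"
  have *: "x * a \<in> carrier (poly_ring V)"
    using R.m_closed[of x a] a x by (auto simp: support_ideal_def)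
  have "supp m \<in> U" if "m \<in> monomials (x * a)" for m
  proof -
    obtain b c where bc: "b \<in> monomials x" "c \<in> monomials a" "m = b + c"
      using \<open>m \<in> monomials (x * a)\<close> monomials_mult by blast
    with a have "supp c \<in> U" by (auto simp: support_ideal_def)
    moreover have "supp m \<subseteq> V" using * that by (auto simp: mem_poly_ring)
    moreover have "supp c \<subseteq> supp m" using bc by (simp add: supp_add)
    ultimately show ?thesis using assms by (auto simp: up_closed_def)
  qed
  with * have "x * a \<in> support_ideal V U" by (auto simp: support_ideal_def)
  then show "x \<otimes>\<^bsub>poly_ring V\<^esub> a \<in> support_ideal V U" "a \<otimes>\<^bsub>poly_ring V\<^esub> x \<in> support_ideal V U"
    by (simp_all add: mult.commute)
qed

lemma coset_eq_iff:
  assumes "ideal J (poly_ring V)" "p \<in> carrier (poly_ring V)" "q \<in> carrier (poly_ring V)"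
  shows "J +>\<^bsub>poly_ring V\<^esub> p = J +>\<^bsub>poly_ring V\<^esub> q \<longleftrightarrow> p - q \<in> J"
  using ring.quotient_eq_iff_same_a_r_cos[OF cring.axioms(1)[OF poly_ring_cring] assms] 
  by (simp add: poly_ring_minus assms)

lemma const_subfield: "subfield poly_constants (poly_ring V :: ('v, 'k::field) mpoly ring)"
proof -
  let ?R = "poly_ring V :: ('v, 'k) mpoly ring"
  interpret R: cring ?R by (rule poly_ring_cring)
  have c: "const c \<in> carrier ?R" for c :: 'k
    by (simp add: mem_poly_ring)
  have "subcring poly_constants ?R"
  proof (rule R.subcringI', rule R.subringI)
    show "poly_constants \<subseteq> carrier ?R" using c by (auto simp: poly_constants_def)
    show "\<one>\<^bsub>?R\<^esub> \<in> poly_constants"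
      unfolding poly_constants_def by (rule image_eqI[of _ _ 1]) simp_all
    fix p q :: "('v, 'k) mpoly" assume "p \<in> poly_constants"
    then obtain a where a: "p = const a" by (auto simp: poly_constants_def)
    show "\<ominus>\<^bsub>?R\<^esub> p \<in> poly_constants"
      using poly_ring_a_inv[OF c[of a]] by (simp add: a poly_constants_def flip: single_uminus)
    assume "q \<in> poly_constants"
    then obtain b where b: "q = const b" by (auto simp: poly_constants_def)
    show "p \<otimes>\<^bsub>?R\<^esub> q \<in> poly_constants" "p \<oplus>\<^bsub>?R\<^esub> q \<in> poly_constants"
      by (simp_all add: a b poly_constants_def mult_single flip: single_add)
  qed
  moreover have "Units (?R\<lparr>carrier := poly_constants\<rparr>) = poly_constants - {\<zero>\<^bsub>?R\<^esub>}"
  proof (intro subset_antisym subsetI)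
    fix p assume "p \<in> Units (?R\<lparr>carrier := poly_constants\<rparr>)"
    then have "p \<in> poly_constants" "\<exists>q. q * p = 1" by (auto simp: Units_def)
    moreover from this(2) have "p \<noteq> 0" by auto
    ultimately show "p \<in> poly_constants - {\<zero>\<^bsub>?R\<^esub>}" by simp
  next
    fix p assume "p \<in> poly_constants - {\<zero>\<^bsub>?R\<^esub>}"
    then obtain a where "p = const a" "a \<noteq> 0" by (fastforce simp: poly_constants_def)
    then have "p * const (inverse a) = 1" "const (inverse a) * p = 1" "p \<in> poly_constants"
      "const (inverse a) \<in> (poly_constants :: ('v, 'k) mpoly set)"
      by (simp_all add: mult_single poly_constants_def)
    then show "p \<in> Units (?R\<lparr>carrier := poly_constants\<rparr>)"
      by (simp add: Units_def) blast
  qed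
  ultimately show ?thesis by (rule R.subfieldI)
qed

text \<open>
  Adding one monomial \<open>m\<close> to the span of cosets is a line extension, and it is strict because an
  element of the ideal has all its supports in \<open>U\<close>, so \<open>m\<close> cannot cancel against other
  standard monomials modulo the ideal.
\<close>
lemma quotient_dimension:
  fixes V :: "'v set" and U :: "'v set set"
  defines "R \<equiv> poly_ring V :: ('v, 'k::field) mpoly ring"
    and "J \<equiv> support_ideal V U :: ('v, 'k::field) mpoly set"
  assumes U: "up_closed V U" and "finite M"
    and M: "\<And>m. m \<in> M \<Longrightarrow> supp m \<subseteq> V \<and> supp m \<notin> U"
  shows "ring.dimension (R Quot J) (card M) ((\<lambda>p. J +>\<^bsub>R\<^esub> p) ` poly_constants)
           ((\<lambda>p. J +>\<^bsub>R\<^esub> p) ` {p. monomials p \<subseteq> M})"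
proof -
  have J: "ideal J R" unfolding R_def J_def by (rule support_ideal_ideal[OF U])
  interpret R: cring R unfolding R_def by (rule poly_ring_cring)
  interpret J: ideal J R by (rule J)
  interpret Q: ring "R Quot J" by (rule J.quotient_is_ring)
  interpret h: ring_hom_ring R "R Quot J" "(+>\<^bsub>R\<^esub>) J" by (rule J.rcos_ring_hom_ring)
  let ?\<pi> = "\<lambda>p. J +>\<^bsub>R\<^esub> p"
  show ?thesis
    using \<open>finite M\<close> M
  proof (induction M rule: finite_induct)
    case empty
    have "?\<pi> 0 = \<zero>\<^bsub>R Quot J\<^esub>" using h.hom_zero by (simp add: R_def)
    then show ?case using Q.zero_dim by simp
  next
    case (insert m M)
    have RM: "monomials p \<subseteq> insert m M \<Longrightarrow> p \<in> carrier R" for p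
      using insert.prems by (auto simp: R_def mem_poly_ring)
    have m: "monomial m \<in> carrier R" using RM[of "monomial m"] by simp
    have constR: "const c \<in> carrier R" for c :: 'k by (simp add: R_def mem_poly_ring)
    have "?\<pi> (monomial m) \<notin> ?\<pi> ` {p. monomials p \<subseteq> M}"
    proof
      assume "?\<pi> (monomial m) \<in> ?\<pi> ` {p. monomials p \<subseteq> M}"
      then obtain p where p: "monomials p \<subseteq> M" "?\<pi> (monomial m) = ?\<pi> p" by auto
      then have "monomial m - p \<in> J"
        using coset_eq_iff[OF J[unfolded R_def], of "monomial m" p] m RM[of p] by (auto simp: R_def)
      moreover have "coef p m = 0"
        using p(1) insert.hyps(2) by (meson in_keys_iff subsetD)
      then have "m \<in> monomials (monomial m - p)"
        by (simp add: in_keys_iff lookup_minus)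
      ultimately show False
        using insert.prems[of m] by (auto simp: J_def support_ideal_def)
    qed
    moreover have "?\<pi> ` {p. monomials p \<subseteq> insert m M}
        = Q.line_extension (?\<pi> ` poly_constants) (?\<pi> (monomial m)) (?\<pi> ` {p. monomials p \<subseteq> M})"
    proof -
      have hom: "?\<pi> (const c * monomial m + q) = ?\<pi> (const c) \<otimes>\<^bsub>R Quot J\<^esub> ?\<pi> (monomial m) \<oplus>\<^bsub>R Quot J\<^esub> ?\<pi> q"
        if "monomials q \<subseteq> M" for c q
      proof -
        have "q \<in> carrier R" using that RM by blast
        then have "?\<pi> (const c \<otimes>\<^bsub>R\<^esub> monomial m \<oplus>\<^bsub>R\<^esub> q)
            = ?\<pi> (const c) \<otimes>\<^bsub>R Quot J\<^esub> ?\<pi> (monomial m) \<oplus>\<^bsub>R Quot J\<^esub> ?\<pi> q"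
          by (simp only: h.hom_add h.hom_mult R.m_closed m constR)
        moreover have "const c \<otimes>\<^bsub>R\<^esub> monomial m \<oplus>\<^bsub>R\<^esub> q = const c * monomial m + q"
          by (simp add: R_def)
        ultimately show ?thesis by simp
      qed
      have split: "p = const (coef p m) * monomial m + part M p \<and> monomials (part M p) \<subseteq> M"
        if "monomials p \<subseteq> insert m M" for p
        using that insert.hyps(2)
        by (auto intro!: poly_mapping_eqI
            simp: mult_single lookup_add lookup_single coef_part when_def in_keys_iff)
      have mem: "monomials (const c * monomial m + q) \<subseteq> insert m M" if "monomials q \<subseteq> M" for c :: 'k and q
        using that by (auto simp: mult_single dest!: monomials_add split: if_splits)
      show ?thesis
      proof (rule Set.set_eqI, unfold Q.line_extension_mem_iff, rule iffI)
        fix u assume "u \<in> ?\<pi> ` {p. monomials p \<subseteq> insert m M}"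
        then obtain p where p: "monomials p \<subseteq> insert m M" "u = ?\<pi> p" by auto
        then have "u = ?\<pi> (const (coef p m)) \<otimes>\<^bsub>R Quot J\<^esub> ?\<pi> (monomial m) \<oplus>\<^bsub>R Quot J\<^esub> ?\<pi> (part M p)"
          using split[of p] hom[of "part M p" "coef p m"] by metis
        then show "\<exists>k\<in>?\<pi> ` poly_constants. \<exists>v\<in>?\<pi> ` {p. monomials p \<subseteq> M}.
            u = k \<otimes>\<^bsub>R Quot J\<^esub> ?\<pi> (monomial m) \<oplus>\<^bsub>R Quot J\<^esub> v"
          using split[OF p(1)] unfolding poly_constants_def by blast
      next
        fix u assume "\<exists>k\<in>?\<pi> ` poly_constants. \<exists>v\<in>?\<pi> ` {p. monomials p \<subseteq> M}.
            u = k \<otimes>\<^bsub>R Quot J\<^esub> ?\<pi> (monomial m) \<oplus>\<^bsub>R Quot J\<^esub> v"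
        then obtain k v where kv: "k \<in> ?\<pi> ` poly_constants" "v \<in> ?\<pi> ` {p. monomials p \<subseteq> M}"
          "u = k \<otimes>\<^bsub>R Quot J\<^esub> ?\<pi> (monomial m) \<oplus>\<^bsub>R Quot J\<^esub> v"
          by (elim bexE)
        then obtain c q where "monomials q \<subseteq> M" "k = ?\<pi> (const c)" "v = ?\<pi> q"
          by (auto simp: poly_constants_def)
        then have "u = ?\<pi> (const c * monomial m + q)" "monomials (const c * monomial m + q) \<subseteq> insert m M"
          using hom[of q c] mem[of q c] kv(3) by simp_all
        then show "u \<in> ?\<pi> ` {p. monomials p \<subseteq> insert m M}" by blast
      qed
    qed
    ultimately show ?case
      using Q.Suc_dim[OF h.hom_closed[OF m]] insert.IH insert.prems insert.hyps by simp
  qed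
qed

section \<open>The cover ideal\<close>
text \<open>
  The exponent vector of the squarefree monomial \<open>\<Prod>i\<in>C. x\<^sub>i\<close>.
\<close>
definition indicator_monomial :: "'v set \<Rightarrow> ('v \<Rightarrow>\<^sub>0 nat)" where
  "indicator_monomial C = (\<Sum>i\<in>C. Poly_Mapping.single i 1)"

lemma lookup_indicator_monomial:
  assumes "finite C"
  shows "Poly_Mapping.lookup (indicator_monomial C) i = (if i \<in> C then 1 else 0)"
proof -
  have "Poly_Mapping.lookup (indicator_monomial C) i = (\<Sum>j\<in>C. if i = j then 1 else 0)"
    by (auto simp: indicator_monomial_def lookup_sum lookup_single when_def intro!: sum.cong)
  then show ?thesis using assms by simp
qed

lemma supp_indicator_monomial: "finite C \<Longrightarrow> supp (indicator_monomial C) = C"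
  by (auto simp: in_keys_iff lookup_indicator_monomial split: if_splits)

lemma prod_pvar:
  assumes "finite C"
  shows "(\<Prod>i\<in>C. pvar i) = (monomial (indicator_monomial C) :: ('v, 'k::field) mpoly)"
  using assms
  by (induction C rule: finite_induct)
     (simp_all add: indicator_monomial_def pvar_def mult_single)

lemma part_insert:
  assumes "m \<notin> A"
  shows "part (insert m A) p = Poly_Mapping.single m (coef p m) + part A p"
  using assms by (intro poly_mapping_eqI) (auto simp: lookup_add lookup_single coef_part when_def)

lemma part_monomials: "part (monomials p) p = p"
  by (rule poly_mapping_eqI) (auto simp: coef_part when_def in_keys_iff)

lemma finite_vertex_cover_minimal:
  assumes "finite C" "vertex_cover V E C"
  shows "\<exists>C'\<subseteq>C. minimal_vertex_cover V E C'"
  using assms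
proof (induction C rule: finite_psubset_induct)
  case (psubset C)
  show ?case
  proof (cases "minimal_vertex_cover V E C")
    case False
    then obtain C' where "C' \<subset> C" "vertex_cover V E C'"
      using psubset.prems by (auto simp: minimal_vertex_cover_def)
    then show ?thesis using psubset.IH[of C'] by blast
  qed blast
qed

lemma up_closed_vertex_cover: "up_closed V {C. vertex_cover V E C}"
  unfolding up_closed_def vertex_cover_def by blast

lemma ideal_mem_of_terms:
  assumes "ideal I (poly_ring V)" and "\<And>m. m \<in> monomials p \<Longrightarrow> Poly_Mapping.single m (coef p m) \<in> I"
  shows "p \<in> I"
proof -
  interpret R: cring "poly_ring V" by (rule poly_ring_cring)
  interpret I: ideal I "poly_ring V" by fact
  have "part A p \<in> I" if "finite A" "A \<subseteq> monomials p" for A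
    using that
  proof (induction A rule: finite_induct)
    case empty
    have "part {} p = 0" by (rule poly_mapping_eqI) (simp add: coef_part)
    then show ?case using I.zero_closed by simp
  next
    case (insert m A)
    then show ?case
      using I.a_closed[OF assms(2)[of m], of "part A p"] by (simp add: part_insert)
  qed
  from this[of "monomials p"] show ?thesis by (simp add: part_monomials)
qed

lemma ideal_mem_multiple_of_squarefree:
  assumes "ideal I (poly_ring V)" "monomial (indicator_monomial C) \<in> I"
    and C: "C \<subseteq> supp m" and mV: "supp m \<subseteq> V"
  shows "Poly_Mapping.single m c \<in> I"
proof -
  interpret I: ideal I "poly_ring V" by fact
  let ?q = "Poly_Mapping.single (m - indicator_monomial C) c"
  have finC: "finite C" using C by (meson finite_keys finite_subset)
  have m: "m = (m - indicator_monomial C) + indicator_monomial C"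
    using C finC
    by (intro poly_mapping_eqI)
       (auto simp: lookup_add lookup_minus lookup_indicator_monomial in_keys_iff Suc_leI)
  have "?q \<in> carrier (poly_ring V)"
    using mV by (auto simp: mem_poly_ring in_keys_iff lookup_minus)
  then have "?q * monomial (indicator_monomial C) \<in> I"
    using I.I_l_closed[OF assms(2), of ?q] by simp
  then show ?thesis using m by (simp add: mult_single)
qed

text \<open>
  A monomial lies in the cover ideal exactly if it is divisible by the product over some minimal
  vertex cover, which means that its support is a vertex cover. Hence \<open>R/J\<close> is the
  Stanley--Reisner ring of the complex of all vertex sets that are not vertex covers.
\<close>
lemma cover_ideal_eq_support_ideal:
  assumes "simple_graph V E"
  shows "cover_ideal V E = (support_ideal V {C. vertex_cover V E C} :: ('v, 'k::field) mpoly set)"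
proof
  let ?R = "poly_ring V :: ('v, 'k) mpoly ring"
  let ?G = "{\<Prod>i\<in>C. pvar i | C. minimal_vertex_cover V E C} :: ('v, 'k) mpoly set"
  let ?J = "support_ideal V {C. vertex_cover V E C} :: ('v, 'k) mpoly set"
  interpret R: cring ?R by (rule poly_ring_cring)
  have finV: "finite V" using assms by (simp add: simple_graph_def)
  have G: "?G \<subseteq> ?J"
  proof
    fix p assume "p \<in> ?G"
    then obtain C where C: "minimal_vertex_cover V E C" "p = (\<Prod>i\<in>C. pvar i)" by auto
    then have "vertex_cover V E C" "C \<subseteq> V" "finite C"
      using finV by (auto simp: minimal_vertex_cover_def vertex_cover_def finite_subset)
    then show "p \<in> ?J"
      by (simp add: C(2) prod_pvar support_ideal_def mem_poly_ring supp_indicator_monomial)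
  qed
  have J: "ideal ?J ?R" by (rule support_ideal_ideal[OF up_closed_vertex_cover])
  show "cover_ideal V E \<subseteq> ?J"
    unfolding cover_ideal_def by (rule R.genideal_minimal[OF J G])
  have GR: "?G \<subseteq> carrier ?R" using G by (auto simp: support_ideal_def)
  interpret I: ideal "cover_ideal V E" ?R
    unfolding cover_ideal_def by (rule R.genideal_ideal[OF GR])
  show "?J \<subseteq> cover_ideal V E"
  proof
    fix p assume p: "p \<in> ?J"
    show "p \<in> cover_ideal V E"
    proof (rule ideal_mem_of_terms[OF I.is_ideal])
      fix m assume "m \<in> monomials p"
      then have cover: "vertex_cover V E (supp m)" and mV: "supp m \<subseteq> V"
        using p by (auto simp: support_ideal_def mem_poly_ring)
      then obtain C where C: "C \<subseteq> supp m" "minimal_vertex_cover V E C"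
        using finite_vertex_cover_minimal by (meson finite_keys)
      have finC: "finite C" using C(1) by (meson finite_keys finite_subset)
      have "monomial (indicator_monomial C) \<in> (cover_ideal V E :: ('v, 'k) mpoly set)"
        unfolding cover_ideal_def
        by (intro subsetD[OF R.genideal_self[OF GR]] CollectI exI[of _ C])
           (simp add: prod_pvar finC C(2))
      then show "Poly_Mapping.single m (coef p m) \<in> cover_ideal V E"
        by (rule ideal_mem_multiple_of_squarefree[OF I.is_ideal _ C(1) mV])
    qed
  qed
qed

section \<open>The Hilbert function\<close>
text \<open>
  Needed twice: for the finiteness of the Hilbert function, and for the count behind the
  algebraic dependence of more polynomials than there are variables.
\<close>
lemma box_of_monomials:
  assumes "finite V"
  shows "finite {m. supp m \<subseteq> V \<and> (\<forall>i\<in>V. Poly_Mapping.lookup m i \<le> D)}" (is "finite ?B")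
    and "card {m. supp m \<subseteq> V \<and> (\<forall>i\<in>V. Poly_Mapping.lookup m i \<le> D)} \<le> Suc D ^ card V"
proof -
  have inj: "inj_on (\<lambda>m. restrict (Poly_Mapping.lookup m) V) ?B"
  proof (rule inj_onI, rule poly_mapping_eqI)
    fix m m' i
    assume *: "m \<in> ?B" "m' \<in> ?B"
      "restrict (Poly_Mapping.lookup m) V = restrict (Poly_Mapping.lookup m') V"
    show "Poly_Mapping.lookup m i = Poly_Mapping.lookup m' i"
    proof (cases "i \<in> V")
      case True
      then show ?thesis using fun_cong[OF *(3), of i] by simp
    next
      case False
      then have "i \<notin> supp m" "i \<notin> supp m'" using * by auto
      then show ?thesis by (simp add: in_keys_iff)
    qed
  qed
  have im: "(\<lambda>m. restrict (Poly_Mapping.lookup m) V) ` ?B \<subseteq> PiE V (\<lambda>_. {..D})"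
    by auto
  have fin: "finite (PiE V (\<lambda>_. {..D}))" using assms by (intro finite_PiE) auto
  show "finite ?B" by (rule inj_on_finite[OF inj im fin])
  show "card ?B \<le> Suc D ^ card V"
    using card_inj_on_le[OF inj im fin] assms by (simp add: card_PiE)
qed

lemma lookup_le_mon_degree: "Poly_Mapping.lookup m i \<le> mon_degree m"
proof (cases "i \<in> supp m")
  case True
  then show ?thesis unfolding mon_degree_def by (intro member_le_sum) auto
qed (simp add: in_keys_iff)

lemma finite_monomials_of_degree:
  assumes "finite V"
  shows "finite {m. supp m \<subseteq> V \<and> mon_degree m = d}"
  by (rule finite_subset[OF _ box_of_monomials(1)[OF assms, of d]])
     (auto intro: lookup_le_mon_degree)

lemma hilbert_series_support_quotient:
  fixes V :: "'v set" and U :: "'v set set"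
  defines "R \<equiv> poly_ring V :: ('v, 'k::field) mpoly ring"
    and "J \<equiv> support_ideal V U :: ('v, 'k::field) mpoly set"
  assumes U: "up_closed V U" and ne: "{} \<notin> U" and finV: "finite V"
  shows "hilbert_series (R Quot J) ((\<lambda>p. J +>\<^bsub>R\<^esub> p) ` poly_constants)
           (\<lambda>d. (\<lambda>p. J +>\<^bsub>R\<^esub> p) ` poly_component V d)
         = Abs_fps (\<lambda>d. int (card {m. supp m \<subseteq> V \<and> supp m \<notin> U \<and> mon_degree m = d}))"
proof -
  have J: "ideal J R" unfolding R_def J_def by (rule support_ideal_ideal[OF U])
  interpret R: cring R unfolding R_def by (rule poly_ring_cring)
  interpret J: ideal J R by (rule J)
  interpret Q: ring "R Quot J" by (rule J.quotient_is_ring)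
  interpret h: ring_hom_ring R "R Quot J" "(+>\<^bsub>R\<^esub>) J" by (rule J.rcos_ring_hom_ring)
  let ?\<pi> = "\<lambda>p. J +>\<^bsub>R\<^esub> p"
  have "?\<pi> 1 \<noteq> ?\<pi> 0"
    using coset_eq_iff[OF J[unfolded R_def], of 1 0] ne
    by (simp add: R_def J_def mem_poly_ring support_ideal_def)
  then have "\<one>\<^bsub>R Quot J\<^esub> \<noteq> \<zero>\<^bsub>R Quot J\<^esub>"
    using h.hom_one h.hom_zero by (simp add: R_def)
  then have K: "subfield (?\<pi> ` poly_constants) (R Quot J)"
    by (intro h.img_is_subfield) (simp_all add: R_def const_subfield)
  have "Q.dim (?\<pi> ` poly_constants) (?\<pi> ` poly_component V d)
        = card {m. supp m \<subseteq> V \<and> supp m \<notin> U \<and> mon_degree m = d}" for d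
  proof -
    let ?M = "{m. supp m \<subseteq> V \<and> supp m \<notin> U \<and> mon_degree m = d}"
    have fin: "finite ?M"
      by (rule finite_subset[OF _ finite_monomials_of_degree[OF finV, of d]]) auto
    have sub: "{p. monomials p \<subseteq> ?M} \<subseteq> poly_component V d"
      by (auto simp: poly_component_def mem_poly_ring)
    have "?\<pi> ` poly_component V d = ?\<pi> ` {p. monomials p \<subseteq> ?M}"
    proof
      show "?\<pi> ` poly_component V d \<subseteq> ?\<pi> ` {p. monomials p \<subseteq> ?M}"
      proof
        fix u assume "u \<in> ?\<pi> ` poly_component V d"
        then obtain p where p: "p \<in> poly_component V d" "u = ?\<pi> p" by auto
        then have pR: "p \<in> carrier R" by (simp add: poly_component_def R_def)
        have "p - part ?M p = part (- ?M) p"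
          using part_add_part_Compl[of ?M p] by (simp add: diff_eq_eq add.commute)
        also have "\<dots> \<in> J"
          using p(1) by (auto simp: J_def support_ideal_def mem_poly_ring poly_component_def)
        finally have "?\<pi> p = ?\<pi> (part ?M p)"
          using coset_eq_iff[OF J[unfolded R_def], of p "part ?M p"] pR
          by (simp add: R_def part_in_poly_ring)
        then show "u \<in> ?\<pi> ` {p. monomials p \<subseteq> ?M}" using p(2) by auto
      qed
    qed (use sub in blast)
    moreover have "Q.dimension (card ?M) (?\<pi> ` poly_constants) (?\<pi> ` {p. monomials p \<subseteq> ?M})"
      unfolding R_def J_def by (rule quotient_dimension[OF U fin]) auto
    ultimately show ?thesis
      using Q.dimI[OF K] by (simp add: over_def)
  qed
  then show ?thesis by (simp add: hilbert_series_def)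
qed

text \<open>
  The zero ring has no subfields, so uniqueness of the dimension cannot come from linear algebra
  over a field. It holds because there is no strict line extension at all.
\<close>
lemma hilbert_series_zero_ring:
  assumes "ring A" "carrier A = {\<zero>\<^bsub>A\<^esub>}" "\<And>d. gr d = {\<zero>\<^bsub>A\<^esub>}"
  shows "hilbert_series A K gr = 0"
proof -
  interpret ring A by fact
  have "n = 0 \<and> F = {\<zero>\<^bsub>A\<^esub>}" if "dimension n K F" for n F
    using that by induction (use assms(2) in auto)
  then have "dim K (gr d) = 0" for d
    unfolding dim_def assms(3) by (intro the_equality) auto
  then show ?thesis by (simp add: hilbert_series_def fps_eq_iff)
qed

section \<open>Primes generated by variables\<close>
text \<open>
  This replaces a monomial order, which is not at hand for variables of an arbitrary type. Among
  the vectors of \<open>A\<close> and of \<open>A'\<close> one keeps those with the smallest exponent of the variable \<open>v\<close>. Two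
  summands with the minimal total exponent of \<open>v\<close> must both be minimal, so a unique sum of the
  smaller sets is also unique for the original sets.
\<close>
lemma unique_sum_exists:
  fixes A A' :: "('v \<Rightarrow>\<^sub>0 nat) set"
  assumes "finite V" "A \<noteq> {}" "A' \<noteq> {}"
    and "\<And>m m' i. m \<in> A \<Longrightarrow> m' \<in> A \<Longrightarrow> i \<notin> V \<Longrightarrow> Poly_Mapping.lookup m i = Poly_Mapping.lookup m' i"
    and "\<And>m m' i. m \<in> A' \<Longrightarrow> m' \<in> A' \<Longrightarrow> i \<notin> V \<Longrightarrow> Poly_Mapping.lookup m i = Poly_Mapping.lookup m' i"
  shows "\<exists>a\<in>A. \<exists>a'\<in>A'. \<forall>m\<in>A. \<forall>m'\<in>A'. m + m' = a + a' \<longrightarrow> m = a \<and> m' = a'"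
  using assms
proof (induction V arbitrary: A A' rule: finite_induct)
  case empty
  obtain a a' where "a \<in> A" "a' \<in> A'" using empty.prems(1,2) by blast
  moreover have "m = a" if "m \<in> A" for m
    using empty.prems(3)[OF that \<open>a \<in> A\<close>] by (intro poly_mapping_eqI) simp
  moreover have "m' = a'" if "m' \<in> A'" for m'
    using empty.prems(4)[OF that \<open>a' \<in> A'\<close>] by (intro poly_mapping_eqI) simp
  ultimately show ?case by blast
next
  case (insert v V)
  let ?e = "\<lambda>m :: 'v \<Rightarrow>\<^sub>0 nat. Poly_Mapping.lookup m v"
  define B where "B = {m \<in> A. \<forall>m'\<in>A. ?e m \<le> ?e m'}"
  define B' where "B' = {m \<in> A'. \<forall>m'\<in>A'. ?e m \<le> ?e m'}"
  have "\<exists>m\<in>S. \<forall>m'\<in>S. ?e m \<le> ?e m'" if "S \<noteq> {}" for S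
    using that ex_has_least_nat[of "\<lambda>m. m \<in> S" _ ?e] by blast
  then have "B \<noteq> {}" "B' \<noteq> {}"
    using insert.prems(1,2) unfolding B_def B'_def by blast+
  moreover have "Poly_Mapping.lookup m i = Poly_Mapping.lookup m' i"
    if "m \<in> B" "m' \<in> B" "i \<notin> V" for m m' i
    using that insert.prems(3)[of m m' i] by (cases "i = v") (auto simp: B_def intro: antisym)
  moreover have "Poly_Mapping.lookup m i = Poly_Mapping.lookup m' i"
    if "m \<in> B'" "m' \<in> B'" "i \<notin> V" for m m' i
    using that insert.prems(4)[of m m' i] by (cases "i = v") (auto simp: B'_def intro: antisym)
  ultimately obtain a a' where a: "a \<in> B" "a' \<in> B'"
    and uniq: "\<And>m m'. m \<in> B \<Longrightarrow> m' \<in> B' \<Longrightarrow> m + m' = a + a' \<Longrightarrow> m = a \<and> m' = a'"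
    using insert.IH[of B B'] by blast
  have "m = a \<and> m' = a'" if m: "m \<in> A" "m' \<in> A'" "m + m' = a + a'" for m m'
  proof -
    have "?e m + ?e m' = ?e a + ?e a'" using m(3) by (metis lookup_add)
    moreover have "?e a \<le> ?e m" "?e a' \<le> ?e m'" using a m by (auto simp: B_def B'_def)
    ultimately have "?e m = ?e a" "?e m' = ?e a'" by linarith+
    then have "m \<in> B" "m' \<in> B'" using a m by (auto simp: B_def B'_def)
    then show ?thesis using uniq m(3) by blast
  qed
  then show ?case using a by (auto simp: B_def B'_def)
qed

lemma coef_mult_unique:
  assumes "\<And>m m'. m \<in> monomials p \<Longrightarrow> m' \<in> monomials q \<Longrightarrow> m + m' = a + a' \<Longrightarrow> m = a \<and> m' = a'"
  shows "coef (p * q) (a + a') = coef p a * coef q a'"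
proof -
  have p: "p = Poly_Mapping.single a (coef p a) + part (- {a}) p"
    by (intro poly_mapping_eqI) (simp add: lookup_add lookup_single coef_part when_def)
  have q: "q = Poly_Mapping.single a' (coef q a') + part (- {a'}) q"
    by (intro poly_mapping_eqI) (simp add: lookup_add lookup_single coef_part when_def)
  have 1: "a + a' \<notin> monomials (part (- {a}) p * q)"
  proof
    assume "a + a' \<in> monomials (part (- {a}) p * q)"
    then obtain m m' where m: "m \<in> monomials (part (- {a}) p)" "m' \<in> monomials q" "a + a' = m + m'"
      using monomials_mult by blast
    then show False using assms[of m m'] by simp
  qed
  have 2: "a + a' \<notin> monomials (Poly_Mapping.single a (coef p a) * part (- {a'}) q)"
  proof
    assume "a + a' \<in> monomials (Poly_Mapping.single a (coef p a) * part (- {a'}) q)"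
    then obtain m' where "a \<in> monomials p" "m' \<in> monomials q" "m' \<noteq> a'" "a + m' = a + a'"
      using monomials_mult[of "a + a'" "Poly_Mapping.single a (coef p a)" "part (- {a'}) q"]
      by (auto simp: in_keys_iff split: if_splits)
    then show False using assms by blast
  qed
  have "p * q = Poly_Mapping.single a (coef p a) * (Poly_Mapping.single a' (coef q a') + part (- {a'}) q)
      + part (- {a}) p * q"
    by (metis p q distrib_right)
  also have "\<dots> = Poly_Mapping.single (a + a') (coef p a * coef q a')
      + Poly_Mapping.single a (coef p a) * part (- {a'}) q + part (- {a}) p * q"
    by (simp add: distrib_left mult_single)
  finally show ?thesis
    using 1 2 by (simp add: lookup_add in_keys_iff)
qed

text \<open>
  The terms avoiding \<open>C\<close> form a nonzero polynomial in the remaining variables, and a product of two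
  such polynomials is nonzero: a sum of exponent vectors attained only once cannot cancel.
\<close>
lemma monomials_of_product:
  assumes "p \<in> carrier (poly_ring V)" "q \<in> carrier (poly_ring V)" "finite V"
    and "m \<in> monomials p" "supp m \<inter> C = {}" "m' \<in> monomials q" "supp m' \<inter> C = {}"
  shows "\<exists>m\<in>monomials (p * q). supp m \<inter> C = {}"
proof -
  let ?A = "{m \<in> monomials p. supp m \<inter> C = {}}" and ?B = "{m \<in> monomials q. supp m \<inter> C = {}}"
  have out: "Poly_Mapping.lookup m i = 0" if "m \<in> monomials r" "r \<in> carrier (poly_ring V)" "i \<notin> V"
    for m i and r :: "('a, 'b) mpoly"
    using that by (force simp: mem_poly_ring in_keys_iff)
  have "\<exists>a\<in>?A. \<exists>b\<in>?B. \<forall>m\<in>?A. \<forall>m'\<in>?B. m + m' = a + b \<longrightarrow> m = a \<and> m' = b"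
    using assms by (intro unique_sum_exists[OF assms(3)]) (auto simp: out)
  then obtain a b where ab: "a \<in> ?A" "b \<in> ?B"
    "\<forall>m\<in>?A. \<forall>m'\<in>?B. m + m' = a + b \<longrightarrow> m = a \<and> m' = b" by blast
  have "coef (p * q) (a + b) = coef p a * coef q b"
  proof (rule coef_mult_unique)
    fix m m' assume *: "m \<in> monomials p" "m' \<in> monomials q" "m + m' = a + b"
    then have "supp m \<union> supp m' = supp a \<union> supp b" by (metis supp_add)
    then have "supp m \<inter> C = {}" "supp m' \<inter> C = {}" using ab(1,2) by auto
    then show "m = a \<and> m' = b" using * ab(3) by simp
  qed
  then have "a + b \<in> monomials (p * q)" using ab(1,2) by (simp add: in_keys_iff)
  moreover have "supp (a + b) \<inter> C = {}" using ab(1,2) by (auto simp: supp_add)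
  ultimately show ?thesis by blast
qed

text \<open>
  The ideal generated by the variables with index in \<open>C\<close>.
\<close>
definition coordinate_prime :: "'v set \<Rightarrow> 'v set \<Rightarrow> ('v, 'k::field) mpoly set" where
  "coordinate_prime V C = support_ideal V {F. F \<inter> C \<noteq> {}}"

lemma primeideal_coordinate_prime:
  assumes "finite V"
  shows "primeideal (coordinate_prime V C :: ('v, 'k::field) mpoly set) (poly_ring V)"
proof (rule primeidealI)
  show "ideal (coordinate_prime V C :: ('v, 'k) mpoly set) (poly_ring V)"
    unfolding coordinate_prime_def by (rule support_ideal_ideal) (auto simp: up_closed_def)
  have "1 \<in> carrier (poly_ring V :: ('v, 'k) mpoly ring)"
    "1 \<notin> (coordinate_prime V C :: ('v, 'k) mpoly set)"
    by (simp_all add: mem_poly_ring coordinate_prime_def support_ideal_def)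
  then show "carrier (poly_ring V) \<noteq> (coordinate_prime V C :: ('v, 'k) mpoly set)" by metis
  fix p q :: "('v, 'k) mpoly"
  assume *: "p \<in> carrier (poly_ring V)" "q \<in> carrier (poly_ring V)"
    and "p \<otimes>\<^bsub>poly_ring V\<^esub> q \<in> coordinate_prime V C"
  then have "\<forall>m\<in>monomials (p * q). supp m \<inter> C \<noteq> {}"
    by (simp add: coordinate_prime_def support_ideal_def)
  then show "p \<in> coordinate_prime V C \<or> q \<in> coordinate_prime V C"
    using monomials_of_product[OF * assms, of _ C] *
    by (auto simp: coordinate_prime_def support_ideal_def)
qed (rule poly_ring_cring)

section \<open>Algebraic dependence and chains of primes\<close>
lemma sum_over_monomials: "(\<Sum>m\<in>monomials p. const (coef p m) * monomial m) = p"
proof (rule poly_mapping_eqI)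
  fix k
  have "coef (\<Sum>m\<in>monomials p. const (coef p m) * monomial m) k
      = (\<Sum>m\<in>monomials p. if m = k then coef p k else 0)"
    by (auto simp: lookup_sum mult_single lookup_single when_def intro!: sum.cong)
  also have "\<dots> = coef p k" by (simp add: in_keys_iff)
  finally show "coef (\<Sum>m\<in>monomials p. const (coef p m) * monomial m) k = coef p k" .
qed

lemma linear_dependence:
  fixes f :: "'a \<Rightarrow> ('v, 'k::field) mpoly"
  assumes T: "finite T" and L: "finite L" and card: "card T < card L"
    and f: "\<And>l. l \<in> L \<Longrightarrow> monomials (f l) \<subseteq> T"
  shows "\<exists>c. (\<exists>l\<in>L. c l \<noteq> 0) \<and> (\<Sum>l\<in>L. const (c l) * f l) = 0"
proof (cases "inj_on f L")
  case True
  interpret vector_space "\<lambda>c (p :: ('v, 'k) mpoly). const c * p"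
  proof
    fix a b :: 'k and x y :: "('v, 'k) mpoly"
    show "const a * (x + y) = const a * x + const a * y" by (rule distrib_left)
    show "const (a + b) * x = const a * x + const b * x" by (simp only: single_add distrib_right)
    have "const a * const b = (const (a * b) :: ('v, 'k) mpoly)" by (simp add: mult_single)
    then show "const a * (const b * x) = const (a * b) * x" by (metis mult.assoc)
    show "const 1 * x = x" by simp
  qed
  have span: "p \<in> span (monomial ` T)" if "monomials p \<subseteq> T" for p :: "('v, 'k) mpoly"
  proof -
    have "(\<Sum>m\<in>monomials p. const (coef p m) * monomial m) \<in> span (monomial ` T)"
      using that by (intro span_sum span_scale span_base) auto
    then show ?thesis by (simp only: sum_over_monomials)
  qed
  have "dependent (f ` L)"
  proof (rule ccontr)
    assume "independent (f ` L)"
    then have "card (f ` L) \<le> card (monomial ` T :: ('v, 'k) mpoly set)"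
      using independent_span_bound[of "monomial ` T" "f ` L"] T f span by blast
    also have "\<dots> \<le> card T" using T by (rule card_image_le)
    finally show False using card by (simp add: card_image True)
  qed
  then obtain u where "\<exists>v\<in>f ` L. u v \<noteq> 0" "(\<Sum>v\<in>f ` L. const (u v) * v) = 0"
    using dependent_finite[of "f ` L"] L by auto
  then show ?thesis
    by (intro exI[of _ "u \<circ> f"]) (simp add: sum.reindex[OF True])
next
  case False
  then obtain x y where xy: "x \<in> L" "y \<in> L" "x \<noteq> y" "f x = f y" by (auto simp: inj_on_def)
  \<comment> \<open>A repeated value gives the dependence \<open>f x - f y = 0\<close>.\<close>
  define c :: "'a \<Rightarrow> 'k" where "c l = (if l = x then 1 else if l = y then - 1 else 0)" for l
  have "(\<Sum>l\<in>L. const (c l) * f l) = (\<Sum>l\<in>{x, y}. const (c l) * f l)"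
    using xy L by (intro sum.mono_neutral_right) (auto simp: c_def)
  also have "\<dots> = 0" using xy by (simp add: c_def single_uminus)
  finally show ?thesis using xy(1) by (intro exI[of _ c]) (auto simp: c_def)
qed

text \<open>
  Evaluation of the monomial with exponent list \<open>l\<close> at the polynomials \<open>ys\<close>. Lists make it
  possible to peel off the first polynomial in the induction along a chain of primes.
\<close>
fun power_product :: "('v, 'k::field) mpoly list \<Rightarrow> nat list \<Rightarrow> ('v, 'k) mpoly" where
  "power_product (y # ys) (a # l) = y ^ a * power_product ys l"
| "power_product _ _ = 1"

definition in_box :: "'v set \<Rightarrow> nat \<Rightarrow> ('v, 'k::field) mpoly \<Rightarrow> bool" where
  "in_box W B p \<longleftrightarrow> (\<forall>m\<in>monomials p. supp m \<subseteq> W \<and> (\<forall>i\<in>W. Poly_Mapping.lookup m i \<le> B))"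

lemma in_box_mult: "in_box W B p \<Longrightarrow> in_box W B' q \<Longrightarrow> in_box W (B + B') (p * q)"
  unfolding in_box_def by (fastforce dest!: monomials_mult simp: supp_add lookup_add intro: add_mono)

lemma in_box_power: "in_box W B p \<Longrightarrow> in_box W (a * B) (p ^ a)"
proof (induction a)
  case 0
  then show ?case by (simp add: in_box_def)
next
  case (Suc a)
  then show ?case using in_box_mult[of W B p "a * B" "p ^ a"] by simp
qed

lemma in_box_power_product:
  assumes "\<And>y. y \<in> set ys \<Longrightarrow> in_box W B y" "\<And>a. a \<in> set l \<Longrightarrow> a \<le> d"
  shows "in_box W (length ys * (d * B)) (power_product ys l)"
  using assms
proof (induction ys l rule: power_product.induct)
  case (1 y ys a l)
  have "in_box W (a * B) (y ^ a)" using 1 by (intro in_box_power) simp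
  moreover have "a * B \<le> d * B" using 1 by simp
  ultimately have "in_box W (d * B) (y ^ a)"
    unfolding in_box_def by (meson order_trans)
  then show ?case using 1 in_box_mult[of W "d * B" "y ^ a"] by simp
qed (auto simp: in_box_def)

text \<open>
  Counting. Let \<open>k\<close> polynomials in \<open>N < k\<close> variables have all exponents at most \<open>B\<close>.
  There are \<open>d ^ k\<close> power products with exponents below \<open>d\<close>, and they all live in the
  span of the at most \<open>(k * d * B + 1) ^ N\<close> monomials with exponents at most \<open>k * d * B\<close>. The
  latter grows only like \<open>d ^ N\<close>, so for large \<open>d\<close> the power products are linearly dependent.
\<close>
lemma algebraic_dependence:
  fixes ys :: "('v, 'k::field) mpoly list"
  assumes W: "finite W" and len: "card W < length ys"
    and ys: "\<And>y m. y \<in> set ys \<Longrightarrow> m \<in> monomials y \<Longrightarrow> supp m \<subseteq> W"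
  shows "\<exists>L c. finite L \<and> (\<forall>l\<in>L. length l = length ys) \<and> (\<exists>l\<in>L. c l \<noteq> 0)
           \<and> (\<Sum>l\<in>L. const (c l) * power_product ys l) = 0"
proof -
  define S where "S = (\<Union>y\<in>set ys. \<Union>m\<in>monomials y. Poly_Mapping.lookup m ` W)"
  define B where "B = Max (insert 0 S)"
  have "finite S" using W by (simp add: S_def)
  then have "b \<le> B" if "b \<in> S" for b using that by (simp add: B_def)
  then have B: "in_box W B y" if "y \<in> set ys" for y
    using that ys unfolding in_box_def S_def by blast
  let ?k = "length ys" and ?N = "card W"
  \<comment> \<open>With \<open>d > e ^ N\<close> the box of side \<open>d * e\<close> in dimension \<open>N\<close> has fewer points than
     \<open>d ^ (N + 1)\<close>.\<close>
  define e where "e = ?k * B + 1"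
  define d where "d = e ^ ?N + 1"
  define L where "L = {l :: nat list. set l \<subseteq> {..<d} \<and> length l = ?k}"
  define T where "T = {m. supp m \<subseteq> W \<and> (\<forall>i\<in>W. Poly_Mapping.lookup m i \<le> ?k * (d * B))}"
  have "card T \<le> Suc (?k * (d * B)) ^ ?N"
    unfolding T_def by (rule box_of_monomials(2)[OF W])
  also have "\<dots> \<le> (d * e) ^ ?N"
    by (rule power_mono) (simp_all add: e_def d_def algebra_simps)
  also have "\<dots> < d ^ ?N * d"
    unfolding power_mult_distrib by (rule mult_strict_left_mono) (simp_all add: d_def)
  also have "\<dots> = d ^ Suc ?N" by simp
  also have "\<dots> \<le> d ^ ?k" using len by (intro power_increasing) (simp_all add: d_def)
  also have "\<dots> = card L" unfolding L_def by (simp add: card_lists_length_eq)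
  finally have card: "card T < card L" .
  have T: "finite T" unfolding T_def by (rule box_of_monomials(1)[OF W])
  have L: "finite L" unfolding L_def by (rule finite_lists_length_eq) simp
  have "monomials (power_product ys l) \<subseteq> T" if "l \<in> L" for l
  proof -
    have "in_box W (?k * (d * B)) (power_product ys l)"
      by (rule in_box_power_product) (use that B in \<open>auto simp: L_def\<close>)
    then show ?thesis by (auto simp: in_box_def T_def)
  qed
  then obtain c where "\<exists>l\<in>L. c l \<noteq> 0" "(\<Sum>l\<in>L. const (c l) * power_product ys l) = 0"
    using linear_dependence[OF T L card, of "power_product ys"] by blast
  moreover have "\<forall>l\<in>L. length l = ?k" by (simp add: L_def)
  ultimately show ?thesis using L by (intro exI[of _ L] exI[of _ c] conjI)
qed

lemma power_product_in_poly_ring: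
  assumes "set ys \<subseteq> carrier (poly_ring V)"
  shows "power_product ys l \<in> carrier (poly_ring V)"
proof -
  interpret cring "poly_ring V" by (rule poly_ring_cring)
  have pow: "y ^ a \<in> carrier (poly_ring V)" if "y \<in> carrier (poly_ring V)" for y a
  proof (induction a)
    case (Suc a)
    then show ?case using m_closed[OF that Suc] by simp
  qed (use one_closed in simp)
  show ?thesis using assms
  proof (induction ys l rule: power_product.induct)
    case (1 y ys a l)
    then show ?case using m_closed[OF pow, of y "power_product ys l" a] by simp
  qed (use one_closed in simp_all)
qed

text \<open>
  Let \<open>y\<^sub>i\<close> lie in \<open>P\<^sub>i\<^sub>+\<^sub>1\<close> but not in \<open>P\<^sub>i\<close>, and suppose that a polynomial expression in
  the \<open>y\<^sub>i\<close> lies in \<open>P\<^sub>0\<close>. Write it as \<open>y\<^sub>0 ^ a * (y\<^sub>0 * G + F)\<close> where \<open>a\<close> is the lowest exponent of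
  \<open>y\<^sub>0\<close>, so that \<open>F\<close> is a nontrivial expression in the remaining \<open>y\<^sub>i\<close> only. Since \<open>y\<^sub>0\<close> is not in
  the prime \<open>P\<^sub>0\<close>, the bracket is in \<open>P\<^sub>0\<close>, and since \<open>y\<^sub>0\<close> is in \<open>P\<^sub>1\<close>, so is \<open>F\<close>. Repeating
  this along the chain leaves a nonzero constant in the last prime.
\<close>
lemma no_relation_along_chain:
  fixes ys :: "('v, 'k::field) mpoly list"
  assumes "\<And>i. i \<le> length ys \<Longrightarrow> primeideal (P i) (poly_ring V)"
    and "\<And>i. i < length ys \<Longrightarrow> P i \<subseteq> P (Suc i)"
    and "\<And>i. i < length ys \<Longrightarrow> ys ! i \<in> P (Suc i)"
    and "\<And>i. i < length ys \<Longrightarrow> ys ! i \<notin> P i"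
    and "finite L" "\<And>l. l \<in> L \<Longrightarrow> length l = length ys" "\<exists>l\<in>L. c l \<noteq> 0"
    and "(\<Sum>l\<in>L. const (c l) * power_product ys l) \<in> P 0"
  shows False
  using assms
proof (induction ys arbitrary: P L c)
  case Nil
  interpret P: primeideal "P 0" "poly_ring V" using Nil.prems(1)[of 0] by simp
  have L: "L = {[]}" "c [] \<noteq> 0" using Nil.prems(6,7) by auto
  then have "const (c []) \<in> P 0" using Nil.prems(8) by simp
  then have "const (inverse (c [])) * const (c []) \<in> P 0"
    using P.I_l_closed[of "const (c [])" "const (inverse (c []))"] by (simp add: mem_poly_ring)
  then have "1 \<in> P 0" using L by (simp add: mult_single)
  then show False using P.one_imp_carrier P.I_notcarr by simp
next
  case (Cons y ys)
  interpret R: cring "poly_ring V :: ('v, 'k) mpoly ring" by (rule poly_ring_cring)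
  interpret P: primeideal "P 0" "poly_ring V" using Cons.prems(1)[of 0] by simp
  interpret P1: primeideal "P 1" "poly_ring V" using Cons.prems(1)[of 1] by simp
  have y: "y \<in> P 1" "y \<notin> P 0" using Cons.prems(3)[of 0] Cons.prems(4)[of 0] by auto
  have sub: "P 0 \<subseteq> P 1" using Cons.prems(2)[of 0] by simp
  have carr: "set (y # ys) \<subseteq> carrier (poly_ring V)"
  proof
    fix z assume "z \<in> set (y # ys)"
    then obtain i where i: "i < length (y # ys)" "z = (y # ys) ! i" by (metis in_set_conv_nth)
    then have "ideal (P (Suc i)) (poly_ring V)"
      using Cons.prems(1)[of "Suc i"] by (simp add: primeideal_def)
    then show "z \<in> carrier (poly_ring V)"
      using ideal.Icarr Cons.prems(3)[OF i(1)] i(2) by metis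
  qed
  have yR: "y ^ a \<in> carrier (poly_ring V)" for a
    using power_product_in_poly_ring[of "[y]" V "[a]"] carr by simp
  have constR: "const x \<in> carrier (poly_ring V)" for x :: 'k by (simp add: mem_poly_ring)
  have ppR: "power_product ys l \<in> carrier (poly_ring V)" for l
    using carr by (intro power_product_in_poly_ring) simp
  have multR: "p * q \<in> carrier (poly_ring V)"
    if "p \<in> carrier (poly_ring V)" "q \<in> carrier (poly_ring V)" for p q :: "('v, 'k) mpoly"
    using R.m_closed[OF that] by simp
  have sumR: "sum f A \<in> carrier (poly_ring V)" if "\<And>x. x \<in> A \<Longrightarrow> f x \<in> carrier (poly_ring V)"
    for f :: "'x \<Rightarrow> ('v, 'k) mpoly" and A
    using that
  proof (induction A rule: infinite_finite_induct)
    case (insert x A)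
    then show ?case using R.a_closed[of "f x" "sum f A"] by simp
  qed (use R.zero_closed in simp_all)
  \<comment> \<open>Only terms with nonzero coefficient count for the lowest exponent \<open>a\<close> of \<open>y\<close>.\<close>
  define L' where "L' = {l \<in> L. c l \<noteq> 0}"
  have L': "finite L'" "L' \<noteq> {}" using Cons.prems(5,7) by (auto simp: L'_def)
  have shape: "\<exists>a l'. l = a # l' \<and> length l' = length ys" if "l \<in> L'" for l
    using that Cons.prems(6)[of l] by (cases l) (auto simp: L'_def)
  define a where "a = Min (hd ` L')"
  have a_le: "a \<le> hd l" if "l \<in> L'" for l using that L' by (simp add: a_def)
  define L0 where "L0 = {l'. a # l' \<in> L'}"
  have "a \<in> hd ` L'" unfolding a_def using L' by (intro Min_in) auto
  then obtain l0 where "l0 \<in> L'" "hd l0 = a" by blast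
  then have L0: "\<exists>l\<in>L0. c (a # l) \<noteq> 0"
    using shape[of l0] by (auto simp: L0_def L'_def)
  have finL0: "finite L0"
    by (rule finite_imageD[of "Cons a"], rule finite_subset[OF _ L'(1)]) (auto simp: L0_def)
  define F where "F = (\<Sum>l\<in>L0. const (c (a # l)) * power_product ys l)"
  define G where "G = (\<Sum>l\<in>L' - Cons a ` L0. const (c l) * (y ^ (hd l - Suc a) * power_product ys (tl l)))"
  have "(\<Sum>l\<in>L. const (c l) * power_product (y # ys) l)
      = (\<Sum>l\<in>L'. const (c l) * power_product (y # ys) l)"
    unfolding L'_def using Cons.prems(5) by (intro sum.mono_neutral_right) auto
  also have "\<dots> = (\<Sum>l\<in>L' - Cons a ` L0. const (c l) * power_product (y # ys) l)
      + (\<Sum>l\<in>Cons a ` L0. const (c l) * power_product (y # ys) l)"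
    by (rule sum.subset_diff) (use L' in \<open>auto simp: L0_def\<close>)
  also have "(\<Sum>l\<in>Cons a ` L0. const (c l) * power_product (y # ys) l) = y ^ a * F"
    by (subst sum.reindex) (simp_all add: F_def sum_distrib_left mult_ac)
  also have "(\<Sum>l\<in>L' - Cons a ` L0. const (c l) * power_product (y # ys) l) = y ^ a * (y * G)"
    unfolding G_def sum_distrib_left
  proof (rule sum.cong[OF refl])
    fix l assume l: "l \<in> L' - Cons a ` L0"
    then obtain b l' where bl: "l = b # l'" using shape by blast
    then have "a < b" using l a_le[of l] by (auto simp: L0_def le_less)
    then have "y ^ b = y ^ a * (y * y ^ (b - Suc a))"
      by (metis Suc_leI add_Suc_shift le_add_diff_inverse power_Suc power_add)
    then show "const (c l) * power_product (y # ys) l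
        = y ^ a * (y * (const (c l) * (y ^ (hd l - Suc a) * power_product ys (tl l))))"
      by (simp add: bl mult_ac)
  qed
  also have "y ^ a * (y * G) + y ^ a * F = y ^ a * (y * G + F)" by (simp add: distrib_left)
  finally have rel: "y ^ a * (y * G + F) \<in> P 0" using Cons.prems(8) by simp
  have FR: "F \<in> carrier (poly_ring V)" unfolding F_def by (intro sumR multR constR ppR)
  have GR: "G \<in> carrier (poly_ring V)" unfolding G_def by (intro sumR multR constR ppR yR)
  have yG: "y * G \<in> P 1" using P1.I_r_closed[OF y(1) GR] by simp
  have yGF: "y * G + F \<in> carrier (poly_ring V)"
    using R.a_closed[OF P1.Icarr[OF yG] FR] by simp
  have "y ^ b \<notin> P 0" for b
  proof (induction b)
    case 0
    then show ?case using P.one_imp_carrier P.I_notcarr by auto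
  next
    case (Suc b)
    then show ?case using P.I_prime[of y "y ^ b"] carr yR y(2) by auto
  qed
  then have "y * G + F \<in> P 0" using P.I_prime[OF yR yGF] rel by auto
  then have "y * G + F \<in> P 1" using sub by blast
  from P1.a_closed[OF P1.a_inv_closed[OF yG] this] have "F \<in> P (Suc 0)"
    by (simp add: poly_ring_a_inv[OF P1.Icarr[OF yG]])
  show False
  proof (rule Cons.IH[of "\<lambda>i. P (Suc i)" L0 "\<lambda>l. c (a # l)"])
    show "(\<Sum>l\<in>L0. const (c (a # l)) * power_product ys l) \<in> P (Suc 0)"
      using \<open>F \<in> P (Suc 0)\<close> by (simp add: F_def)
    show "length l = length ys" if "l \<in> L0" for l using that shape by (force simp: L0_def)
    fix i assume i: "i < length ys"
    show "P (Suc i) \<subseteq> P (Suc (Suc i))" "ys ! i \<in> P (Suc (Suc i))" "ys ! i \<notin> P (Suc i)"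
      using Cons.prems(2)[of "Suc i"] Cons.prems(3)[of "Suc i"] Cons.prems(4)[of "Suc i"] i by auto
  qed (use finL0 L0 Cons.prems(1) in auto)
qed

section \<open>The Krull dimension of the quotient\<close>
text \<open>
  Because \<open>P\<close> contains \<open>J\<close>, it is a union of cosets of \<open>J\<close>. So primality and strict inclusions
  carry over from primes above \<open>J\<close> to their images.
\<close>
lemma quotient_coset_mem_iff:
  assumes J: "ideal J (poly_ring V)" and P: "ideal P (poly_ring V)" and "J \<subseteq> P"
    and a: "a \<in> carrier (poly_ring V)"
  shows "J +>\<^bsub>poly_ring V\<^esub> a \<in> (\<lambda>p. J +>\<^bsub>poly_ring V\<^esub> p) ` P \<longleftrightarrow> a \<in> P"
proof
  interpret R: cring "poly_ring V" by (rule poly_ring_cring)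
  interpret P: ideal P "poly_ring V" by (rule P)
  assume "J +>\<^bsub>poly_ring V\<^esub> a \<in> (\<lambda>p. J +>\<^bsub>poly_ring V\<^esub> p) ` P"
  then obtain p where p: "p \<in> P" "J +>\<^bsub>poly_ring V\<^esub> a = J +>\<^bsub>poly_ring V\<^esub> p" by (elim imageE)
  have "a - p \<in> J" using p(2) coset_eq_iff[OF J a P.Icarr[OF p(1)]] by simp
  then have "a - p \<in> P" using assms(3) by (rule subsetD[rotated])
  then show "a \<in> P" using P.a_closed[OF _ p(1), of "a - p"] by simp
qed (rule imageI)

lemma carrier_quotient:
  "carrier (poly_ring V Quot J) = (\<lambda>p. J +>\<^bsub>poly_ring V\<^esub> p) ` carrier (poly_ring V)"
  by (auto simp: FactRing_def A_RCOSETS_def')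

lemma primeideal_image_in_quotient:
  assumes J: "ideal J (poly_ring V)" and P: "primeideal P (poly_ring V)" and "J \<subseteq> P"
  shows "primeideal ((\<lambda>p. J +>\<^bsub>poly_ring V\<^esub> p) ` P) (poly_ring V Quot J)"
proof (rule primeidealI)
  interpret R: cring "poly_ring V" by (rule poly_ring_cring)
  interpret P: primeideal P "poly_ring V" by (rule P)
  interpret J: ideal J "poly_ring V" by (rule J)
  interpret h: ring_hom_ring "poly_ring V" "poly_ring V Quot J" "(+>\<^bsub>poly_ring V\<^esub>) J"
    by (rule J.rcos_ring_hom_ring)
  note mem = quotient_coset_mem_iff[OF J P.is_ideal assms(3)]
  show "ideal ((\<lambda>p. J +>\<^bsub>poly_ring V\<^esub> p) ` P) (poly_ring V Quot J)"
    by (rule R.ring_ideal_imp_quot_ideal[OF J P.is_ideal])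
  show "cring (poly_ring V Quot J)"
    by (rule J.quotient_is_cring[OF poly_ring_cring])
  have "1 \<notin> P" using P.one_imp_carrier P.I_notcarr by auto
  then have 1: "J +>\<^bsub>poly_ring V\<^esub> 1 \<notin> (\<lambda>p. J +>\<^bsub>poly_ring V\<^esub> p) ` P"
    using mem[of 1] R.one_closed by simp
  have 2: "J +>\<^bsub>poly_ring V\<^esub> 1 \<in> carrier (poly_ring V Quot J)"
    unfolding carrier_quotient using R.one_closed by (intro imageI) simp
  show "carrier (poly_ring V Quot J) \<noteq> (\<lambda>p. J +>\<^bsub>poly_ring V\<^esub> p) ` P"
  proof
    assume eq: "carrier (poly_ring V Quot J) = (\<lambda>p. J +>\<^bsub>poly_ring V\<^esub> p) ` P"
    from 2[unfolded eq] 1 show False by contradiction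
  qed
  fix u v assume "u \<in> carrier (poly_ring V Quot J)" "v \<in> carrier (poly_ring V Quot J)"
    and uv: "u \<otimes>\<^bsub>poly_ring V Quot J\<^esub> v \<in> (\<lambda>p. J +>\<^bsub>poly_ring V\<^esub> p) ` P"
  then obtain a b where ab: "a \<in> carrier (poly_ring V)" "b \<in> carrier (poly_ring V)"
    "u = J +>\<^bsub>poly_ring V\<^esub> a" "v = J +>\<^bsub>poly_ring V\<^esub> b"
    unfolding carrier_quotient by (elim imageE)
  have "J +>\<^bsub>poly_ring V\<^esub> (a \<otimes>\<^bsub>poly_ring V\<^esub> b) \<in> (\<lambda>p. J +>\<^bsub>poly_ring V\<^esub> p) ` P"
    using uv ab by (simp only: h.hom_mult)
  then have "a \<otimes>\<^bsub>poly_ring V\<^esub> b \<in> P" by (simp only: mem[OF R.m_closed[OF ab(1,2)]])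
  then have "a \<in> P \<or> b \<in> P" by (rule P.I_prime[OF ab(1,2)])
  then show "u \<in> (\<lambda>p. J +>\<^bsub>poly_ring V\<^esub> p) ` P \<or> v \<in> (\<lambda>p. J +>\<^bsub>poly_ring V\<^esub> p) ` P"
    unfolding ab(3,4) mem[OF ab(1)] mem[OF ab(2)] .
qed

lemma coordinate_prime_mem_iff:
  "p \<in> coordinate_prime V C \<longleftrightarrow>
     (\<forall>m\<in>monomials p. supp m \<subseteq> V) \<and> (\<forall>m\<in>monomials p. supp m \<inter> C \<noteq> {})"
  by (simp add: coordinate_prime_def support_ideal_def mem_poly_ring)

lemma pvar_in_coordinate_prime:
  "(pvar i :: ('v, 'k::field) mpoly) \<in> coordinate_prime V C \<longleftrightarrow> i \<in> V \<and> i \<in> C"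
  by (auto simp: coordinate_prime_mem_iff pvar_def)

lemma coordinate_prime_subset:
  fixes I :: "('v, 'k::field) mpoly set"
  assumes "ideal I (poly_ring V)" "\<And>i. i \<in> C \<Longrightarrow> pvar i \<in> I"
  shows "coordinate_prime V C \<subseteq> I"
proof
  fix p :: "('v, 'k) mpoly" assume p: "p \<in> coordinate_prime V C"
  show "p \<in> I"
  proof (rule ideal_mem_of_terms[OF assms(1)])
    fix m assume "m \<in> monomials p"
    then obtain i where i: "i \<in> supp m" "i \<in> C" and mV: "supp m \<subseteq> V"
      using p unfolding coordinate_prime_mem_iff by blast
    have "monomial (indicator_monomial {i}) = (pvar i :: ('v, 'k) mpoly)"
      by (simp flip: prod_pvar)
    then show "Poly_Mapping.single m (coef p m) \<in> I"
      using ideal_mem_multiple_of_squarefree[OF assms(1), of "{i}"] i assms(2)[of i] mV by simp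
  qed
qed

text \<open>
  Elements witnessing the strict inclusions can be chosen free of the variables in \<open>C\<close>, since these
  variables already lie in \<open>P\<^sub>0\<close>. A chain with more steps than remaining variables would then
  give algebraically dependent witnesses, which is excluded. For \<open>C = {}\<close> this is the upper bound
  for the dimension of a polynomial ring.
\<close>
lemma prime_chain_length_bound:
  fixes P :: "nat \<Rightarrow> ('v, 'k::field) mpoly set"
  assumes V: "finite V"
    and P: "\<And>i. i \<le> l \<Longrightarrow> primeideal (P i) (poly_ring V)"
    and strict: "\<And>i. i < l \<Longrightarrow> P i \<subset> P (Suc i)"
    and var: "\<And>i. i \<in> C \<Longrightarrow> pvar i \<in> P 0"
  shows "l \<le> card (V - C)"
proof (rule ccontr)
  interpret R: cring "poly_ring V :: ('v, 'k) mpoly ring" by (rule poly_ring_cring)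
  define W where "W = V - C"
  assume "\<not> l \<le> card (V - C)"
  then have l: "card W < l" by (simp add: W_def)
  have mono: "P i \<subseteq> P j" if "i \<le> j" "j \<le> l" for i j
    using that
  proof (induction j rule: dec_induct)
    case (step n)
    then show ?case using strict[of n] by auto
  qed simp
  have idl: "ideal (P i) (poly_ring V)" if "i \<le> l" for i using P[OF that] by (simp add: primeideal_def)
  have C0: "coordinate_prime V C \<subseteq> P 0"
    by (rule coordinate_prime_subset[OF idl]) (use var in auto)
  have "\<exists>y. y \<in> P (Suc i) \<and> y \<notin> P i \<and> (\<forall>m\<in>monomials y. supp m \<subseteq> W)" if i: "i < l" for i
  proof -
    interpret I: ideal "P i" "poly_ring V" using idl i by simp
    interpret I': ideal "P (Suc i)" "poly_ring V" using idl i by simp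
    obtain y where y: "y \<in> P (Suc i)" "y \<notin> P i" using strict[OF i] by blast
    \<comment> \<open>The part \<open>w\<close> of \<open>y\<close> involving variables of \<open>C\<close> is already in \<open>P i\<close>, so \<open>z\<close> is as good a witness.\<close>
    define z where "z = part {m. supp m \<subseteq> W} y"
    define w where "w = part (- {m. supp m \<subseteq> W}) y"
    have yR: "y \<in> carrier (poly_ring V)" using I'.Icarr[OF y(1)] .
    then have "w \<in> coordinate_prime V C"
      by (auto simp: w_def W_def coordinate_prime_mem_iff mem_poly_ring)
    then have w: "w \<in> P i" "w \<in> P (Suc i)"
      using C0 mono[of 0 i] mono[of 0 "Suc i"] i by auto
    have yzw: "y = z + w" by (simp add: z_def w_def part_add_part_Compl)
    have "z \<notin> P i" using I.a_closed[of z w] w y(2) yzw by auto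
    moreover have "z \<in> P (Suc i)"
      using I'.a_closed[OF y(1) I'.a_inv_closed[OF w(2)]] yzw
      by (simp add: poly_ring_a_inv[OF I'.Icarr[OF w(2)]])
    ultimately show ?thesis by (intro exI[of _ z]) (auto simp: z_def)
  qed
  then obtain y where y: "\<And>i. i < l \<Longrightarrow> y i \<in> P (Suc i)" "\<And>i. i < l \<Longrightarrow> y i \<notin> P i"
    "\<And>i m. i < l \<Longrightarrow> m \<in> monomials (y i) \<Longrightarrow> supp m \<subseteq> W" by metis
  define ys where "ys = map y [0..<l]"
  have "finite W" using V by (simp add: W_def)
  then obtain L c where L: "finite L" "\<And>k. k \<in> L \<Longrightarrow> length k = length ys" "\<exists>k\<in>L. c k \<noteq> 0"
    "(\<Sum>k\<in>L. const (c k) * power_product ys k) = 0"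
    using algebraic_dependence[of W ys] l y(3) by (force simp: ys_def)
  have "0 \<in> P 0" using additive_subgroup.zero_closed[OF ideal.axioms(1)[OF idl[of 0]]] by simp
  then show False
    using no_relation_along_chain[of ys P V L c] L P strict y by (auto simp: ys_def)
qed

text \<open>
  This is the reason why \<open>J\<close> is the intersection of the ideals \<open>(x\<^sub>i, x\<^sub>j)\<close> over the edges. If
  every edge had an endpoint whose variable is not in \<open>P\<close>, these endpoints would form a vertex
  cover, and its product would be in \<open>J\<close>, hence in \<open>P\<close>.
\<close>
lemma prime_over_cover_ideal:
  fixes P :: "('v, 'k::field) mpoly set"
  assumes "simple_graph V E" "primeideal P (poly_ring V)"
    and "cover_ideal V E \<subseteq> P"
  shows "\<exists>e\<in>E. \<forall>i\<in>e. pvar i \<in> P"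
proof (rule ccontr)
  interpret P: primeideal P "poly_ring V" by fact
  assume no: "\<not> ?thesis"
  \<comment> \<open>\<open>D\<close> collects the variables outside \<open>P\<close>; no product of them is in the prime \<open>P\<close>.\<close>
  define D where "D = {i \<in> V. pvar i \<notin> P}"
  have finD: "finite D" using assms(1) by (simp add: D_def simple_graph_def)
  have "vertex_cover V E D"
    using no assms(1) unfolding vertex_cover_def D_def simple_graph_def by blast
  then have "monomial (indicator_monomial D) \<in> (cover_ideal V E :: ('v, 'k) mpoly set)"
    unfolding cover_ideal_eq_support_ideal[OF assms(1)]
    by (simp add: support_ideal_def mem_poly_ring supp_indicator_monomial[OF finD] vertex_cover_def)
  then have "(\<Prod>i\<in>D. pvar i) \<in> P"
    using assms(3) by (auto simp: prod_pvar[OF finD])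
  moreover have "(\<Prod>i\<in>F. pvar i) \<notin> P" if "F \<subseteq> D" for F
    using finite_subset[OF that finD] that
  proof (induction F rule: finite_induct)
    case empty
    then show ?case using P.one_imp_carrier P.I_notcarr by auto
  next
    case (insert i F)
    have "pvar i \<in> carrier (poly_ring V)"
      using insert.prems by (simp add: D_def pvar_def mem_poly_ring)
    moreover have "(\<Prod>i\<in>F. pvar i) \<in> carrier (poly_ring V)"
      using insert by (simp add: prod_pvar mem_poly_ring supp_indicator_monomial) (auto simp: D_def)
    ultimately show ?case
      using P.I_prime[of "pvar i" "\<Prod>i\<in>F. pvar i"] insert by (auto simp: D_def)
  qed
  ultimately show False by blast
qed

text \<open>
  Every prime above \<open>J\<close> contains the two variables of some edge, which leaves at most \<open>n - 2\<close>
  strict steps. Conversely, starting from the prime of an edge and adding the other variables one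
  by one gives a chain with exactly \<open>n - 2\<close> steps.
\<close>
lemma krull_dim_cover_quotient:
  fixes V :: "'v set" and E :: "'v set set"
  defines "R \<equiv> poly_ring V :: ('v, 'k::field) mpoly ring"
    and "J \<equiv> cover_ideal V E :: ('v, 'k::field) mpoly set"
  assumes G: "simple_graph V E" and "E \<noteq> {}"
  shows "krull_dim (R Quot J) = enat (card V - 2)"
proof -
  have V: "finite V" and edge: "\<And>e. e \<in> E \<Longrightarrow> e \<subseteq> V \<and> card e = 2"
    using G by (auto simp: simple_graph_def)
  have cardW: "card (V - e) = card V - 2" if "e \<in> E" for e
    using edge[OF that] V card_Diff_subset[of e V] finite_subset[of e V] by simp
  have Jeq: "J = support_ideal V {C. vertex_cover V E C}"
    unfolding J_def by (rule cover_ideal_eq_support_ideal[OF G])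
  have J: "ideal J R"
    unfolding Jeq R_def by (rule support_ideal_ideal[OF up_closed_vertex_cover])
  interpret R: cring R unfolding R_def by (rule poly_ring_cring)
  interpret J: ideal J R by (rule J)
  interpret h: ring_hom_ring R "R Quot J" "(+>\<^bsub>R\<^esub>) J" by (rule J.rcos_ring_hom_ring)
  let ?\<pi> = "\<lambda>p. J +>\<^bsub>R\<^esub> p"
  let ?chain = "\<lambda>l P. (\<forall>i\<le>l. primeideal (P i) (R Quot J)) \<and> (\<forall>i<l. P i \<subset> P (Suc i))"
  have upper: "l \<le> card V - 2" if "?chain l P" for l P
  proof -
    \<comment> \<open>Pull the chain back to the polynomial ring.\<close>
    define P' where "P' i = {r \<in> carrier R. ?\<pi> r \<in> P i}" for i
    have P': "primeideal (P' i) R" if "i \<le> l" for i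
      unfolding P'_def using h.primeideal_vimage[OF R.is_cring] \<open>?chain l P\<close> that by blast
    have strict: "P' i \<subset> P' (Suc i)" if "i < l" for i
    proof -
      have sub: "P i \<subset> P (Suc i)" using \<open>?chain l P\<close> that by blast
      interpret Q: primeideal "P (Suc i)" "R Quot J" using \<open>?chain l P\<close> that by simp
      obtain u where u: "u \<in> P (Suc i)" "u \<notin> P i" using sub by blast
      then obtain r where "r \<in> carrier R" "u = ?\<pi> r"
        using Q.Icarr[OF u(1)] unfolding R_def carrier_quotient by blast
      then show ?thesis using u sub unfolding P'_def by blast
    qed
    have "J \<subseteq> P' 0"
    proof
      fix r assume r: "r \<in> J"
      then have "?\<pi> r = \<zero>\<^bsub>R Quot J\<^esub>"
        using h.hom_zero coset_eq_iff[OF J[unfolded R_def], of r 0] J.Icarr[OF r]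
        by (simp add: R_def mem_poly_ring)
      moreover have "additive_subgroup (P 0) (R Quot J)"
        using \<open>?chain l P\<close> by (simp add: primeideal_def ideal_def)
      ultimately show "r \<in> P' 0"
        using additive_subgroup.zero_closed J.Icarr[OF r] by (force simp: P'_def)
    qed
    then obtain e where e: "e \<in> E" "\<forall>i\<in>e. pvar i \<in> P' 0"
      using prime_over_cover_ideal[OF G, of "P' 0"] P'[of 0] unfolding R_def J_def by blast
    then have "l \<le> card (V - e)"
      using prime_chain_length_bound[OF V, of l P' e] P' strict e(2) unfolding R_def by blast
    then show ?thesis using cardW[OF e(1)] by simp
  qed
  \<comment> \<open>The chain attaining the bound.\<close>
  obtain e where e: "e \<in> E" using \<open>E \<noteq> {}\<close> by blast
  obtain xs where xs: "set xs = V - e" "distinct xs"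
    using finite_distinct_list[of "V - e"] V by auto
  then have len: "length xs = card V - 2" using cardW[OF e] distinct_card[of xs] by simp
  define P where "P i = (coordinate_prime V (e \<union> set (take i xs)) :: ('v, 'k) mpoly set)" for i
  have P: "primeideal (P i) R" for i
    unfolding P_def R_def by (rule primeideal_coordinate_prime[OF V])
  have JP: "J \<subseteq> P i" for i
    using e unfolding Jeq P_def coordinate_prime_def support_ideal_def vertex_cover_def by blast
  have strict: "P i \<subset> P (Suc i)" if "i < length xs" for i
  proof -
    have "P i \<subseteq> P (Suc i)"
      using set_take_subset_set_take[of i "Suc i" xs]
      unfolding P_def coordinate_prime_mem_iff subset_iff by (auto; blast)
    moreover have x: "xs ! i \<in> V" "xs ! i \<notin> e" using nth_mem[OF that] xs(1) by auto
    moreover have "xs ! i \<notin> set (take i xs)"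
      using xs(2) that by (auto simp: in_set_conv_nth nth_eq_iff_index_eq)
    moreover have "xs ! i \<in> set (take (Suc i) xs)" using that by (simp add: take_Suc_conv_app_nth)
    ultimately have "pvar (xs ! i) \<in> P (Suc i)" "pvar (xs ! i) \<notin> P i"
      unfolding P_def pvar_in_coordinate_prime by auto
    then show ?thesis using \<open>P i \<subseteq> P (Suc i)\<close> by blast
  qed
  have "?chain (card V - 2) (\<lambda>i. ?\<pi> ` P i)"
  proof (intro conjI allI impI)
    fix i
    show "primeideal (?\<pi> ` P i) (R Quot J)"
      using primeideal_image_in_quotient J P JP unfolding R_def by blast
    assume "i < card V - 2"
    then obtain p where p: "p \<in> P (Suc i)" "p \<notin> P i" and sub: "P i \<subseteq> P (Suc i)"
      using strict[of i] len by auto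
    have "p \<in> carrier R" using ideal.Icarr[OF primeideal.axioms(1)[OF P] p(1)] .
    then have "?\<pi> p \<notin> ?\<pi> ` P i"
      using quotient_coset_mem_iff[of J V "P i" p] J primeideal.axioms(1)[OF P[of i]] JP p(2)
      unfolding R_def by blast
    then show "?\<pi> ` P i \<subset> ?\<pi> ` P (Suc i)" using p(1) sub by blast
  qed
  then have lower: "enat (card V - 2) \<in> {enat l | l. \<exists>P. ?chain l P}"
    by (intro CollectI exI[of _ "card V - 2"] conjI[OF refl] exI[of _ "\<lambda>i. ?\<pi> ` P i"])
  show ?thesis unfolding krull_dim_def
  proof (rule antisym)
    show "enat (card V - 2) \<le> Sup {enat l | l. \<exists>P. ?chain l P}" using lower by (rule Sup_upper)
    show "Sup {enat l | l. \<exists>P. ?chain l P} \<le> enat (card V - 2)"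
    proof (rule Sup_least)
      fix x assume "x \<in> {enat l | l. \<exists>P. ?chain l P}"
      then obtain l P where l: "x = enat l" and P: "?chain l P"
        unfolding mem_Collect_eq by (elim exE conjE) (rule that, assumption, rule conjI)
      from P have "l \<le> card V - 2" by (rule upper)
      then show "x \<le> enat (card V - 2)" using l by simp
    qed
  qed
qed

section \<open>Counting monomials by support\<close>
lemma mon_degree_eq_sum:
  "finite A \<Longrightarrow> supp m \<subseteq> A \<Longrightarrow> mon_degree m = (\<Sum>i\<in>A. Poly_Mapping.lookup m i)"
  unfolding mon_degree_def by (intro sum.mono_neutral_left) (auto simp: in_keys_iff)

lemma mon_degree_add: "mon_degree (m + m') = mon_degree m + mon_degree m'"
  by (simp add: mon_degree_eq_sum[of "supp m \<union> supp m'"] supp_add lookup_add sum.distrib)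

lemma mon_degree_single [simp]: "mon_degree (Poly_Mapping.single i a) = a"
  by (simp add: mon_degree_def)

lemma mon_degree_eq_0_iff: "mon_degree m = 0 \<longleftrightarrow> m = 0"
  by (auto simp: mon_degree_def in_keys_iff intro: poly_mapping_eqI)

definition full_support_count :: "'v set \<Rightarrow> nat \<Rightarrow> nat" where
  "full_support_count F d = card {m :: 'v \<Rightarrow>\<^sub>0 nat. supp m = F \<and> mon_degree m = d}"

lemma finite_full_support:
  "finite F \<Longrightarrow> finite {m. supp m = F \<and> mon_degree m = d}"
  by (rule finite_subset[OF _ finite_monomials_of_degree[of F d]]) auto

text \<open>
  Lowering the exponent of \<open>v\<close> by one either keeps \<open>v\<close> in the support or removes it.
\<close>
lemma full_support_count_insert:
  assumes "finite F" "v \<notin> F"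
  shows "full_support_count (insert v F) (Suc d)
         = full_support_count (insert v F) d + full_support_count F d"
proof -
  let ?A = "\<lambda>F d. {m. supp m = F \<and> mon_degree m = d}"
  let ?x = "Poly_Mapping.single v (1::nat)"
  have eq: "?A (insert v F) (Suc d) = (\<lambda>m. m + ?x) ` (?A (insert v F) d \<union> ?A F d)"
  proof
    show "?A (insert v F) (Suc d) \<subseteq> (\<lambda>m. m + ?x) ` (?A (insert v F) d \<union> ?A F d)"
    proof
      fix m assume m: "m \<in> ?A (insert v F) (Suc d)"
      then have pos: "Poly_Mapping.lookup m v \<noteq> 0" by (auto simp: in_keys_iff)
      then have eq: "m = (m - ?x) + ?x"
        by (intro poly_mapping_eqI) (auto simp: lookup_add lookup_minus lookup_single when_def)
      have "mon_degree m = Suc (mon_degree (m - ?x))"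
        using arg_cong[OF eq, of mon_degree] by (simp add: mon_degree_add)
      moreover have "supp m = supp (m - ?x) \<union> {v}"
        using arg_cong[OF eq, of supp] by (simp add: supp_add)
      ultimately have "m - ?x \<in> ?A (insert v F) d \<union> ?A F d"
        using m assms(2) by (cases "v \<in> supp (m - ?x)") auto
      with eq show "m \<in> (\<lambda>m. m + ?x) ` (?A (insert v F) d \<union> ?A F d)" by (rule image_eqI)
    qed
    show "(\<lambda>m. m + ?x) ` (?A (insert v F) d \<union> ?A F d) \<subseteq> ?A (insert v F) (Suc d)"
    proof
      fix u assume "u \<in> (\<lambda>m. m + ?x) ` (?A (insert v F) d \<union> ?A F d)"
      then obtain m where "u = m + ?x" "supp m = insert v F \<or> supp m = F" "mon_degree m = d" by blast
      then show "u \<in> ?A (insert v F) (Suc d)" by (elim disjE) (simp_all add: supp_add mon_degree_add)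
    qed
  qed
  have inj: "inj_on (\<lambda>m. m + ?x) (?A (insert v F) d \<union> ?A F d)"
    by (rule inj_onI) (rule add_right_imp_eq)
  have fin: "finite (?A (insert v F) d)" "finite (?A F d)"
    using assms(1) by (simp_all add: finite_full_support)
  have disj: "?A (insert v F) d \<inter> ?A F d = {}" using assms(2) by blast
  have "card (?A (insert v F) (Suc d)) = card ((\<lambda>m. m + ?x) ` (?A (insert v F) d \<union> ?A F d))"
    by (rule arg_cong[OF eq])
  also have "\<dots> = card (?A (insert v F) d \<union> ?A F d)" by (rule card_image[OF inj])
  also have "\<dots> = card (?A (insert v F) d) + card (?A F d)" by (rule card_Un_disjoint[OF fin disj])
  finally show ?thesis by (simp only: full_support_count_def)
qed

text \<open>
  The series is \<open>(t / (1 - t)) ^ card F\<close>: each variable of \<open>F\<close> contributes \<open>t + t\<^sup>2 + \<dots>\<close>.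
\<close>
lemma full_support_series:
  assumes "finite F"
  shows "Abs_fps (\<lambda>d. int (full_support_count F d)) * (1 - fps_X) ^ card F = fps_X ^ card F"
  using assms
proof (induction F rule: finite_induct)
  case empty
  have "{m :: 'a \<Rightarrow>\<^sub>0 nat. supp m = {} \<and> mon_degree m = d} = (if d = 0 then {0} else {})" for d
    by (auto simp: mon_degree_def)
  then show ?case by (simp add: full_support_count_def fps_eq_iff)
next
  case (insert v F)
  let ?S = "\<lambda>F. Abs_fps (\<lambda>d. int (full_support_count F d))"
  have 0: "full_support_count (insert v F) 0 = 0"
    by (auto simp: full_support_count_def mon_degree_eq_0_iff)
  have "?S (insert v F) * (1 - fps_X) = fps_X * ?S F"
  proof (rule fps_ext)
    fix d
    show "fps_nth (?S (insert v F) * (1 - fps_X)) d = fps_nth (fps_X * ?S F) d"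
      using insert.hyps
      by (cases d) (simp_all add: right_diff_distrib 0 full_support_count_insert)
  qed
  then have "?S (insert v F) * (1 - fps_X) * (1 - fps_X) ^ card F = fps_X * fps_X ^ card F"
    by (simp only: mult.assoc[of fps_X] insert.IH)
  then show ?case
    unfolding card_insert_disjoint[OF insert.hyps(1,2)] power_Suc by (simp only: mult.assoc)
qed

lemma support_series:
  fixes V :: "'v set"
  assumes V: "finite V" and N: "\<And>F. F \<subseteq> V \<Longrightarrow> F \<notin> U \<Longrightarrow> card F \<le> N"
  shows "Abs_fps (\<lambda>d. int (card {m. supp m \<subseteq> V \<and> supp m \<notin> U \<and> mon_degree m = d})) * (1 - fps_X) ^ N
         = (\<Sum>F | F \<subseteq> V \<and> F \<notin> U. fps_X ^ card F * (1 - fps_X) ^ (N - card F))"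
proof -
  let ?D = "{F. F \<subseteq> V \<and> F \<notin> U}"
  have fin: "finite ?D" using V by simp
  have finF: "finite F" if "F \<in> ?D" for F using that V finite_subset by auto
  have "card {m. supp m \<subseteq> V \<and> supp m \<notin> U \<and> mon_degree m = d}
      = (\<Sum>F\<in>?D. full_support_count F d)" for d
  proof -
    have "{m. supp m \<subseteq> V \<and> supp m \<notin> U \<and> mon_degree m = d}
        = (\<Union>F\<in>?D. {m. supp m = F \<and> mon_degree m = d})" by auto
    then show ?thesis
      unfolding full_support_count_def
      using fin finF by (simp only:) (rule card_UN_disjoint; auto intro: finite_full_support)
  qed
  then have "Abs_fps (\<lambda>d. int (card {m. supp m \<subseteq> V \<and> supp m \<notin> U \<and> mon_degree m = d}))
      = (\<Sum>F\<in>?D. Abs_fps (\<lambda>d. int (full_support_count F d)))"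
    by (simp add: fps_eq_iff fps_sum_nth)
  also have "\<dots> * (1 - fps_X) ^ N = (\<Sum>F\<in>?D. Abs_fps (\<lambda>d. int (full_support_count F d)) * (1 - fps_X) ^ N)"
    by (simp add: sum_distrib_right)
  also have "\<dots> = (\<Sum>F\<in>?D. fps_X ^ card F * (1 - fps_X) ^ (N - card F))"
  proof (rule sum.cong[OF refl])
    fix F assume F: "F \<in> ?D"
    then have "N = card F + (N - card F)" using N[of F] by simp
    then have "(1 - fps_X :: int fps) ^ N = (1 - fps_X) ^ card F * (1 - fps_X) ^ (N - card F)"
      by (metis power_add)
    then show "Abs_fps (\<lambda>d. int (full_support_count F d)) * (1 - fps_X) ^ N
        = fps_X ^ card F * (1 - fps_X) ^ (N - card F)"
      by (simp only: mult.assoc[symmetric] full_support_series[OF finF[OF F]])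
  qed
  finally show ?thesis .
qed

section \<open>The generating polynomial of the dependent sets\<close>
lemma arithmetic_progression_series:
  fixes x :: "'a::comm_ring_1"
  shows "(1 - x)\<^sup>2 * (\<Sum>k<m. of_nat (k + 1) * x ^ k) = 1 - of_nat (m + 1) * x ^ m + of_nat m * x ^ (m + 1)"
proof (induction m)
  case (Suc m)
  have "(1 - x)\<^sup>2 * (\<Sum>k<Suc m. of_nat (k + 1) * x ^ k)
      = (1 - x)\<^sup>2 * (\<Sum>k<m. of_nat (k + 1) * x ^ k) + (1 - x)\<^sup>2 * (of_nat (m + 1) * x ^ m)"
    by (simp only: sum.lessThan_Suc distrib_left)
  also have "\<dots> = 1 - of_nat (m + 1) * x ^ m + of_nat m * x ^ (m + 1) + (1 - x)\<^sup>2 * (of_nat (m + 1) * x ^ m)"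
    by (simp only: Suc.IH)
  also have "\<dots> = 1 - of_nat (Suc m + 1) * x ^ Suc m + of_nat (Suc m) * x ^ (Suc m + 1)"
    by (simp add: algebra_simps power2_eq_square)
  finally show ?case .
qed simp

text \<open>
  After multiplication by \<open>(1 - x)\<^sup>2\<close> the left side is \<open>((1 - x) + x) ^ n\<close> without its first two
  binomial terms, and the right side telescopes to the same polynomial.
\<close>
lemma binomial_tail_sum:
  fixes x :: "'a::idom"
  assumes "x \<noteq> 1"
  shows "(\<Sum>j=2..n. of_nat (n choose j) * (x ^ (n - j) * (1 - x) ^ (j - 2)))
         = (\<Sum>k<n - 1. of_nat (k + 1) * x ^ k)"
proof (cases n)
  case (Suc m)
  have "(1 - x)\<^sup>2 * (\<Sum>j=2..n. of_nat (n choose j) * (x ^ (n - j) * (1 - x) ^ (j - 2)))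
      = (\<Sum>j=2..n. of_nat (n choose j) * (1 - x) ^ j * x ^ (n - j))"
    unfolding sum_distrib_left
  proof (rule sum.cong[OF refl])
    fix j assume "j \<in> {2..n}"
    then have "2 \<le> j" by simp
    then have "j = 2 + (j - 2)" by linarith
    then have "(1 - x) ^ j = (1 - x)\<^sup>2 * (1 - x) ^ (j - 2)" by (metis power_add)
    then show "(1 - x)\<^sup>2 * (of_nat (n choose j) * (x ^ (n - j) * (1 - x) ^ (j - 2)))
        = of_nat (n choose j) * (1 - x) ^ j * x ^ (n - j)" by (simp add: mult_ac)
  qed
  also have "\<dots> = ((1 - x) + x) ^ n - (\<Sum>j\<in>{0, 1}. of_nat (n choose j) * (1 - x) ^ j * x ^ (n - j))"
  proof -
    have "{..n} = {0, 1} \<union> {2..n}" using Suc by auto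
    then have "((1 - x) + x) ^ n = (\<Sum>j\<in>{0, 1} \<union> {2..n}. of_nat (n choose j) * (1 - x) ^ j * x ^ (n - j))"
      by (simp only: binomial_ring)
    then show ?thesis by (subst (asm) sum.union_disjoint) (auto simp: eq_diff_eq add_ac)
  qed
  also have "\<dots> = 1 - of_nat (m + 1) * x ^ m + of_nat m * x ^ (m + 1)"
    using Suc by (simp add: algebra_simps)
  also have "\<dots> = (1 - x)\<^sup>2 * (\<Sum>k<m. of_nat (k + 1) * x ^ k)"
    by (simp only: arithmetic_progression_series)
  finally show ?thesis using assms Suc by simp
qed simp

lemma binomial_expansion_shifted:
  fixes x :: "'a::comm_ring_1"
  assumes "2 \<le> j" "j \<le> n"
  shows "x ^ (n - j) * (1 - x) ^ (j - 2)
         = (\<Sum>m=2..j. of_int (int (j - 2 choose (m - 2)) * (- 1) ^ (j - m)) * x ^ (n - m))"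
proof -
  have "(1 - x) ^ (j - 2) = (1 + (- x)) ^ (j - 2)" by simp
  also have "\<dots> = (\<Sum>k\<le>j - 2. of_nat (j - 2 choose k) * (- x) ^ (j - 2 - k))"
    by (subst binomial_ring) simp
  also have "\<dots> = (\<Sum>m=2..j. of_nat (j - 2 choose (m - 2)) * (- x) ^ (j - m))"
    using assms by (intro sum.reindex_bij_witness[of _ "\<lambda>m. m - 2" "\<lambda>k. k + 2"]) auto
  finally have "x ^ (n - j) * (1 - x) ^ (j - 2)
      = (\<Sum>m=2..j. x ^ (n - j) * (of_nat (j - 2 choose (m - 2)) * (- x) ^ (j - m)))"
    by (simp add: sum_distrib_left)
  also have "\<dots> = (\<Sum>m=2..j. of_int (int (j - 2 choose (m - 2)) * (- 1) ^ (j - m)) * x ^ (n - m))"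
  proof (rule sum.cong[OF refl])
    fix m assume m: "m \<in> {2..j}"
    then have "n - m = (n - j) + (j - m)" using assms by simp
    then have "x ^ (n - m) = x ^ (n - j) * x ^ (j - m)" by (simp only: power_add)
    moreover have "(- x) ^ (j - m) = (- 1) ^ (j - m) * x ^ (j - m)" by (rule power_minus)
    ultimately show "x ^ (n - j) * (of_nat (j - 2 choose (m - 2)) * (- x) ^ (j - m))
        = of_int (int (j - 2 choose (m - 2)) * (- 1) ^ (j - m)) * x ^ (n - m)"
      by (simp add: mult_ac)
  qed
  finally show ?thesis .
qed

text \<open>
  The coefficients of the \<open>h\<close>-polynomial. The binomials \<open>n choose j\<close> account for \<open>n - m + 1\<close>; the
  alternating sum comes from expanding each \<open>(1 - x) ^ (j - 2)\<close> and collecting the power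
  \<open>x ^ (n - m)\<close>.
\<close>
lemma dependent_sum_expansion:
  fixes x :: "'a::idom" and g :: "nat \<Rightarrow> nat"
  assumes "x \<noteq> 1"
  shows "(\<Sum>j=2..n. of_int (int (n choose j) - int (g j)) * (x ^ (n - j) * (1 - x) ^ (j - 2)))
    = (\<Sum>m=2..n. of_int ((int n - int m + 1)
         - (\<Sum>j=m..n. int (j - 2 choose (m - 2)) * (- 1) ^ (j - m) * int (g j))) * x ^ (n - m))"
proof -
  let ?b = "\<lambda>j m. int (j - 2 choose (m - 2)) * (- 1) ^ (j - m)"
  have "(\<Sum>j=2..n. of_int (int (n choose j) - int (g j)) * (x ^ (n - j) * (1 - x) ^ (j - 2)))
      = (\<Sum>j=2..n. of_nat (n choose j) * (x ^ (n - j) * (1 - x) ^ (j - 2)))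
        - (\<Sum>j=2..n. of_nat (g j) * (x ^ (n - j) * (1 - x) ^ (j - 2)))"
    by (simp add: left_diff_distrib sum_subtractf)
  also have "(\<Sum>j=2..n. of_nat (n choose j) * (x ^ (n - j) * (1 - x) ^ (j - 2)))
      = (\<Sum>m=2..n. of_int (int n - int m + 1) * x ^ (n - m))"
    unfolding binomial_tail_sum[OF assms]
    by (intro sum.reindex_bij_witness[of _ "\<lambda>m. n - m" "\<lambda>k. n - k"]) (auto simp: of_nat_diff)
  also have "(\<Sum>j=2..n. of_nat (g j) * (x ^ (n - j) * (1 - x) ^ (j - 2)))
      = (\<Sum>j=2..n. \<Sum>m\<in>{m \<in> {2..n}. m \<le> j}. of_int (?b j m * int (g j)) * x ^ (n - m))"
  proof (rule sum.cong[OF refl])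
    fix j assume j: "j \<in> {2..n}"
    then have "{m \<in> {2..n}. m \<le> j} = {2..j}" by auto
    then show "of_nat (g j) * (x ^ (n - j) * (1 - x) ^ (j - 2))
        = (\<Sum>m\<in>{m \<in> {2..n}. m \<le> j}. of_int (?b j m * int (g j)) * x ^ (n - m))"
      using j by (simp add: binomial_expansion_shifted sum_distrib_left mult_ac)
  qed
  also have "\<dots> = (\<Sum>m=2..n. \<Sum>j\<in>{j \<in> {2..n}. m \<le> j}. of_int (?b j m * int (g j)) * x ^ (n - m))"
    by (rule sum.swap_restrict) auto
  also have "\<dots> = (\<Sum>m=2..n. of_int (\<Sum>j=m..n. ?b j m * int (g j)) * x ^ (n - m))"
  proof (rule sum.cong[OF refl])
    fix m assume "m \<in> {2..n}"
    then have "{j \<in> {2..n}. m \<le> j} = {m..n}" by auto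
    then show "(\<Sum>j\<in>{j \<in> {2..n}. m \<le> j}. of_int (?b j m * int (g j)) * x ^ (n - m))
        = of_int (\<Sum>j=m..n. ?b j m * int (g j)) * x ^ (n - m)"
      by (simp add: sum_distrib_right)
  qed
  finally show ?thesis by (simp add: left_diff_distrib sum_subtractf)
qed

section \<open>The h-polynomial\<close>
text \<open>
  A set that is not independent contains an edge, so it has at least two elements; this makes
  \<open>j - 2\<close> an honest exponent in the application.
\<close>
lemma sum_over_dependent_sets:
  fixes \<psi> :: "nat \<Rightarrow> 'a::comm_ring_1"
  assumes G: "simple_graph V E"
  shows "(\<Sum>T | T \<subseteq> V \<and> T \<notin> independent_sets V E. \<psi> (card T))
    = (\<Sum>j=2..card V. of_int (int (card V choose j) - int (num_independent_sets V E j)) * \<psi> j)"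
proof -
  let ?D = "{T. T \<subseteq> V \<and> T \<notin> independent_sets V E}"
  have V: "finite V" and edge: "\<And>e. e \<in> E \<Longrightarrow> card e = 2"
    using G by (auto simp: simple_graph_def)
  have fin: "finite ?D" using V by simp
  have range: "card ` ?D \<subseteq> {2..card V}"
  proof
    fix j assume "j \<in> card ` ?D"
    then obtain T where T: "j = card T" "T \<subseteq> V" "T \<notin> independent_sets V E" by blast
    then obtain e where "e \<in> E" "e \<subseteq> T" by (auto simp: independent_sets_def)
    moreover have "finite T" using T(2) V finite_subset by blast
    ultimately have "2 \<le> card T" using card_mono[of T e] edge by simp
    then show "j \<in> {2..card V}" using T card_mono[OF V T(2)] by simp
  qed
  have count: "int (card {T \<in> ?D. card T = j}) = int (card V choose j) - int (num_independent_sets V E j)"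
    for j
  proof -
    let ?I = "{S \<in> independent_sets V E. card S = j}"
    have split: "{T. T \<subseteq> V \<and> card T = j} = {T \<in> ?D. card T = j} \<union> ?I"
      by (auto simp: independent_sets_def)
    have disj: "{T \<in> ?D. card T = j} \<inter> ?I = {}" by auto
    have fin_I: "finite ?I"
      by (rule finite_subset[of _ "Pow V"]) (use V in \<open>auto simp: independent_sets_def\<close>)
    have fin_D: "finite {T \<in> ?D. card T = j}" by (rule finite_subset[OF _ fin]) auto
    have "card V choose j = card {T. T \<subseteq> V \<and> card T = j}" by (simp only: n_subsets[OF V])
    also have "\<dots> = card ({T \<in> ?D. card T = j} \<union> ?I)" by (rule arg_cong[OF split])
    also have "\<dots> = card {T \<in> ?D. card T = j} + card ?I" by (rule card_Un_disjoint[OF fin_D fin_I disj])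
    finally have "card V choose j = card {T \<in> ?D. card T = j} + num_independent_sets V E j"
      by (simp only: num_independent_sets_def)
    then show ?thesis by linarith
  qed
  have "(\<Sum>T\<in>?D. \<psi> (card T)) = (\<Sum>j=2..card V. \<Sum>T\<in>{T \<in> ?D. card T = j}. \<psi> (card T))"
    by (rule sum.group[symmetric, OF fin _ range]) simp
  also have "\<dots> = (\<Sum>j=2..card V. of_int (int (card {T \<in> ?D. card T = j})) * \<psi> j)"
    by (intro sum.cong[OF refl]) simp
  finally show ?thesis by (simp only: count)
qed

text \<open>
  A set fails to be a vertex cover exactly if its complement is not independent. Passing to
  complements turns the sum over faces of the Stanley--Reisner complex into a sum over sets
  that are not independent.
\<close>
lemma cover_quotient_hilbert_series:
  fixes V :: "'v set" and E :: "'v set set"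
  assumes G: "simple_graph V E" and "E \<noteq> {}"
  shows "Abs_fps (\<lambda>d. int (card {m. supp m \<subseteq> V \<and> \<not> vertex_cover V E (supp m) \<and> mon_degree m = d}))
           * (1 - fps_X) ^ (card V - 2)
         = (\<Sum>j=2..card V. of_int (int (card V choose j) - int (num_independent_sets V E j))
              * (fps_X ^ (card V - j) * (1 - fps_X) ^ (j - 2)))"
proof -
  let ?n = "card V"
  have V: "finite V" and edge: "\<And>e. e \<in> E \<Longrightarrow> e \<subseteq> V \<and> card e = 2"
    using G by (auto simp: simple_graph_def)
  have cover: "vertex_cover V E F \<longleftrightarrow> V - F \<in> independent_sets V E" if "F \<subseteq> V" for F
    using edge that unfolding vertex_cover_def independent_sets_def by blast
  have bound: "card F \<le> ?n - 2" if F: "F \<subseteq> V" "F \<notin> {C. vertex_cover V E C}" for F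
  proof -
    obtain e where e: "e \<in> E" "e \<inter> F = {}" using F by (auto simp: vertex_cover_def)
    then have "F \<subseteq> V - e" using F by blast
    then have "card F \<le> card (V - e)" using V by (intro card_mono) auto
    also have "\<dots> = ?n - 2"
      using edge[OF e(1)] V card_Diff_subset[of e V] finite_subset[of e V] by simp
    finally show ?thesis .
  qed
  have "(\<Sum>F | F \<subseteq> V \<and> \<not> vertex_cover V E F. fps_X ^ card F * (1 - fps_X :: int fps) ^ (?n - 2 - card F))
      = (\<Sum>T | T \<subseteq> V \<and> T \<notin> independent_sets V E. fps_X ^ (?n - card T) * (1 - fps_X) ^ (card T - 2))"
  proof (rule sum.reindex_bij_witness[of _ "\<lambda>T. V - T" "\<lambda>F. V - F"])
    fix F assume "F \<in> {F. F \<subseteq> V \<and> \<not> vertex_cover V E F}"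
    then have F: "F \<subseteq> V" "\<not> vertex_cover V E F" by auto
    show "V - (V - F) = F" using F(1) by blast
    show "V - F \<in> {T. T \<subseteq> V \<and> T \<notin> independent_sets V E}" using F cover by blast
    have "card F \<le> ?n" "card (V - F) = ?n - card F"
      using F(1) V by (auto intro: card_mono card_Diff_subset finite_subset)
    then have "?n - card (V - F) = card F" "card (V - F) - 2 = ?n - 2 - card F" by simp_all
    then show "fps_X ^ (?n - card (V - F)) * (1 - fps_X) ^ (card (V - F) - 2)
        = fps_X ^ card F * (1 - fps_X :: int fps) ^ (?n - 2 - card F)" by simp
  next
    fix T assume "T \<in> {T. T \<subseteq> V \<and> T \<notin> independent_sets V E}"
    then have T: "T \<subseteq> V" "T \<notin> independent_sets V E" by auto
    show TT: "V - (V - T) = T" using T(1) by blast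
    show "V - T \<in> {F. F \<subseteq> V \<and> \<not> vertex_cover V E F}"
      using T(2) cover[of "V - T"] unfolding TT by blast
  qed
  also have "\<dots> = (\<Sum>j=2..?n. of_int (int (?n choose j) - int (num_independent_sets V E j))
      * (fps_X ^ (?n - j) * (1 - fps_X) ^ (j - 2)))"
    by (rule sum_over_dependent_sets[OF G])
  finally have "(\<Sum>F | F \<subseteq> V \<and> F \<notin> {C. vertex_cover V E C}.
        fps_X ^ card F * (1 - fps_X :: int fps) ^ (?n - 2 - card F))
      = (\<Sum>j=2..?n. of_int (int (?n choose j) - int (num_independent_sets V E j))
        * (fps_X ^ (?n - j) * (1 - fps_X) ^ (j - 2)))"
    by (simp only: mem_Collect_eq)
  moreover have "Abs_fps (\<lambda>d. int (card {m. supp m \<subseteq> V \<and> supp m \<notin> {C. vertex_cover V E C}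
        \<and> mon_degree m = d})) * (1 - fps_X) ^ (?n - 2)
      = (\<Sum>F | F \<subseteq> V \<and> F \<notin> {C. vertex_cover V E C}. fps_X ^ card F * (1 - fps_X) ^ (?n - 2 - card F))"
    by (rule support_series[OF V]) (rule bound)
  ultimately show ?thesis by (simp only: mem_Collect_eq)
qed

lemma fps_of_poly_of_int: "fps_of_poly (of_int c) = (of_int c :: int fps)"
  by (induction c rule: int_induct[of _ 0]) (simp_all add: fps_of_poly_add fps_of_poly_diff)

text \<open>
  Without edges, \<open>J\<close> is the whole ring and the quotient is zero. Then both sides vanish: every
  vertex set is independent, so \<open>num_independent_sets V E j\<close> equals \<open>card V choose j\<close>.
\<close>
lemma h_polynomial_quot_cover_ideal:
  fixes V :: "'v set" and E :: "'v set set"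
  assumes G: "simple_graph V E"
  shows "h_polynomial_quot V (cover_ideal V E :: ('v, 'k::field) mpoly set)
    = (\<Sum>j=2..card V. of_int (int (card V choose j) - int (num_independent_sets V E j))
              * (monom 1 1 ^ (card V - j) * (1 - monom 1 1) ^ (j - 2)))" (is "_ = ?h")
proof -
  let ?R = "poly_ring V :: ('v, 'k) mpoly ring" and ?J = "cover_ideal V E :: ('v, 'k) mpoly set"
  let ?\<pi> = "\<lambda>p. ?J +>\<^bsub>?R\<^esub> p"
  have V: "finite V" using G by (simp add: simple_graph_def)
  have Jeq: "?J = support_ideal V {C. vertex_cover V E C}"
    by (rule cover_ideal_eq_support_ideal[OF G])
  have fps_h: "fps_of_poly ?h
      = (\<Sum>j=2..card V. of_int (int (card V choose j) - int (num_independent_sets V E j))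
              * (fps_X ^ (card V - j) * (1 - fps_X) ^ (j - 2)))"
    by (simp only: fps_of_poly_sum fps_of_poly_mult fps_of_poly_power fps_of_poly_diff
        fps_of_poly_of_int fps_of_poly_monom' fps_of_poly_1 power_one_right)
  have "fps_of_poly ?h = hilbert_series (?R Quot ?J) (?\<pi> ` poly_constants) (\<lambda>d. ?\<pi> ` poly_component V d)
      * (1 - fps_X) ^ the_enat (krull_dim (?R Quot ?J))"
  proof (cases "E = {}")
    case False
    then have "{} \<notin> {C. vertex_cover V E C}" by (auto simp: vertex_cover_def)
    then have "hilbert_series (?R Quot ?J) (?\<pi> ` poly_constants) (\<lambda>d. ?\<pi> ` poly_component V d)
        = Abs_fps (\<lambda>d. int (card {m. supp m \<subseteq> V \<and> supp m \<notin> {C. vertex_cover V E C} \<and> mon_degree m = d}))"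
      unfolding Jeq by (rule hilbert_series_support_quotient[OF up_closed_vertex_cover _ V])
    then show ?thesis
      using cover_quotient_hilbert_series[OF G False] krull_dim_cover_quotient[OF G False, where 'k = 'k]
      by (simp only: fps_h the_enat.simps mem_Collect_eq)
  next
    case True
    have JR: "?J = carrier ?R"
      unfolding Jeq by (simp add: support_ideal_def vertex_cover_def poly_ring_def True)
    have J: "ideal ?J ?R" unfolding Jeq by (rule support_ideal_ideal[OF up_closed_vertex_cover])
    interpret J: ideal ?J ?R by (rule J)
    interpret h: ring_hom_ring ?R "?R Quot ?J" ?\<pi> by (rule J.rcos_ring_hom_ring)
    have zero: "?\<pi> p = \<zero>\<^bsub>?R Quot ?J\<^esub>" if "p \<in> carrier ?R" for p
    proof -
      have "0 \<in> carrier ?R" by (simp add: mem_poly_ring)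
      then have "?\<pi> p = ?\<pi> 0"
        using coset_eq_iff[OF J that, of 0] that by (simp only: JR diff_zero)
      then show ?thesis using h.hom_zero by simp
    qed
    have "hilbert_series (?R Quot ?J) (?\<pi> ` poly_constants) (\<lambda>d. ?\<pi> ` poly_component V d) = 0"
    proof (rule hilbert_series_zero_ring)
      show "ring (?R Quot ?J)" by (rule J.quotient_is_ring)
      have im: "?\<pi> ` A = {\<zero>\<^bsub>?R Quot ?J\<^esub>}" if "0 \<in> A" "A \<subseteq> carrier ?R" for A
      proof
        show "?\<pi> ` A \<subseteq> {\<zero>\<^bsub>?R Quot ?J\<^esub>}" using zero that(2) by (intro image_subsetI) (simp add: subsetD)
        have "?\<pi> 0 \<in> ?\<pi> ` A" using that(1) by (rule imageI)
        then show "{\<zero>\<^bsub>?R Quot ?J\<^esub>} \<subseteq> ?\<pi> ` A" using zero[of 0] that by (simp add: subsetD)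
      qed
      show "carrier (?R Quot ?J) = {\<zero>\<^bsub>?R Quot ?J\<^esub>}"
        unfolding carrier_quotient by (rule im) (simp_all add: mem_poly_ring)
      show "?\<pi> ` poly_component V d = {\<zero>\<^bsub>?R Quot ?J\<^esub>}" for d
        by (rule im) (auto simp: poly_component_def mem_poly_ring)
    qed
    moreover have "?h = 0"
    proof -
      have "{T. T \<subseteq> V \<and> T \<notin> independent_sets V E} = {}"
        using True by (auto simp: independent_sets_def)
      then show ?thesis
        using sum_over_dependent_sets[OF G, of "\<lambda>j. monom 1 1 ^ (card V - j) * (1 - monom 1 1 :: int poly) ^ (j - 2)"]
        by (simp only: sum.empty)
    qed
    ultimately show ?thesis by (simp only: fps_of_poly_0 mult_zero_left)
  qed
  then show ?thesis
    unfolding h_polynomial_quot_def h_polynomial_def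
    by (intro the_equality) (auto simp flip: fps_of_poly_eq_iff)
qed

lemma of_int_times_monom_power: "of_int c * monom 1 1 ^ k = (monom c k :: int poly)"
  by (simp add: monom_power of_int_poly smult_monom)

lemma independence_number_bounds:
  assumes G: "simple_graph V E"
  shows "independence_number V E \<le> card V"
    and "V \<noteq> {} \<Longrightarrow> 1 \<le> independence_number V E"
    and "independence_number V E < j \<Longrightarrow> num_independent_sets V E j = 0"
proof -
  have V: "finite V" and edge: "\<And>e. e \<in> E \<Longrightarrow> card e = 2"
    using G by (auto simp: simple_graph_def)
  have sub: "independent_sets V E \<subseteq> Pow V" by (auto simp: independent_sets_def)
  then have fin: "finite (independent_sets V E)" using V finite_subset by blast
  have small: "S \<in> independent_sets V E" if "S \<subseteq> V" "card S < 2" for S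
  proof -
    have "finite S" using that V finite_subset by blast
    then have "\<not> e \<subseteq> S" if "e \<in> E" for e using card_mono[of S e] edge[OF that] \<open>card S < 2\<close> by linarith
    then show ?thesis using that by (auto simp: independent_sets_def)
  qed
  have le: "card S \<le> independence_number V E" if "S \<in> independent_sets V E" for S
    unfolding independence_number_def using fin that by simp
  have "card ` independent_sets V E \<noteq> {}" using small[of "{}"] by auto
  then have "independence_number V E \<in> card ` independent_sets V E"
    unfolding independence_number_def using fin by (intro Max_in) auto
  then show "independence_number V E \<le> card V"
    using sub card_mono[OF V] by auto
  show "1 \<le> independence_number V E" if ne: "V \<noteq> {}"
  proof -
    obtain v where "v \<in> V" using ne by blast
    then show ?thesis using le[OF small[of "{v}"]] by simp
  qed
  assume "independence_number V E < j"
  then have "{S \<in> independent_sets V E. card S = j} = {}" using le by fastforce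
  then show "num_independent_sets V E j = 0" by (simp only: num_independent_sets_def card.empty)
qed

theorem theorem3p5:
  fixes V :: "'v set" and E :: "'v set set" and n \<alpha> :: nat and g :: "nat \<Rightarrow> nat"
    and Ecoeff :: "int \<Rightarrow> int"
  assumes "simple_graph V E"
    and "n = card V"
    and "\<alpha> = independence_number V E"
    and "\<And>j. g j = num_independent_sets V E j"
    and "\<And>s. -1 \<le> s \<Longrightarrow> s \<le> int \<alpha> - 3 \<Longrightarrow>
           Ecoeff (s + 3) =
             (int n - s - 2)
             - (\<Sum>j = s + 3..int \<alpha>. int (nat (j - 2) choose nat (s + 1))
                                    * (- 1) ^ nat (j - s - 1) * int (g (nat j)))"
  shows "h_polynomial_quot V (cover_ideal V E :: ('v, 'k::field) mpoly set)
         = (\<Sum>k = 0..int n - int \<alpha> - 1. monom (k + 1) (nat k))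
           + (\<Sum>s = -1..int \<alpha> - 3. monom (Ecoeff (s + 3)) (nat (int n - s - 3)))"
proof -
  define c where "c m = (int n - int m + 1)
      - (\<Sum>j=m..n. int (j - 2 choose (m - 2)) * (- 1) ^ (j - m) * int (g j))" for m
  have \<alpha>n: "\<alpha> \<le> n" and g0: "\<And>j. \<alpha> < j \<Longrightarrow> g j = 0"
    using independence_number_bounds[OF assms(1)] assms(2-4) by auto
  have \<alpha>1: "n = 0 \<or> 1 \<le> \<alpha>"
    using independence_number_bounds(2)[OF assms(1)] assms(1-3) by (auto simp: simple_graph_def)
  have "h_polynomial_quot V (cover_ideal V E :: ('v, 'k) mpoly set)
      = (\<Sum>j=2..n. of_int (int (n choose j) - int (g j)) * (monom 1 1 ^ (n - j) * (1 - monom 1 1) ^ (j - 2)))"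
    unfolding h_polynomial_quot_cover_ideal[OF assms(1)] assms(2,4) ..
  also have "\<dots> = (\<Sum>m=2..n. of_int (c m) * monom 1 1 ^ (n - m))"
    unfolding c_def by (rule dependent_sum_expansion) (simp add: monom_eq_1_iff)
  also have "\<dots> = (\<Sum>m=2..n. monom (c m) (n - m))"
    by (simp only: of_int_times_monom_power)
  \<comment> \<open>For \<open>m > \<alpha>\<close> no independent set has \<open>m\<close> or more elements, and the coefficient of \<open>t ^ (n - m)\<close> is
     just \<open>n - m + 1\<close>. With \<open>k = n - m\<close> this is the first sum; \<open>m = s + 3\<close> gives the second.
     The split needs \<open>\<alpha> \<ge> 1\<close>, which holds as soon as there is a vertex.\<close>
  also have "{2..n} = {\<alpha> + 1..n} \<union> {2..\<alpha>}" using \<alpha>1 \<alpha>n by auto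
  also have "(\<Sum>m\<in>\<dots>. monom (c m) (n - m))
      = (\<Sum>m=\<alpha> + 1..n. monom (c m) (n - m)) + (\<Sum>m=2..\<alpha>. monom (c m) (n - m))"
    by (rule sum.union_disjoint) auto
  also have "(\<Sum>m=\<alpha> + 1..n. monom (c m) (n - m)) = (\<Sum>k = 0..int n - int \<alpha> - 1. monom (k + 1) (nat k))"
  proof (rule sum.reindex_bij_witness[of _ "\<lambda>k. nat (int n - k)" "\<lambda>m. int n - int m"])
    fix m assume m: "m \<in> {\<alpha> + 1..n}"
    then have "c m = int n - int m + 1" by (simp add: c_def g0)
    moreover have "nat (int n - int m) = n - m" using m by simp
    ultimately show "monom (int n - int m + 1) (nat (int n - int m)) = monom (c m) (n - m)" by simp
  qed auto
  also have "(\<Sum>m=2..\<alpha>. monom (c m) (n - m))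
      = (\<Sum>s = -1..int \<alpha> - 3. monom (Ecoeff (s + 3)) (nat (int n - s - 3)))"
  proof (rule sum.reindex_bij_witness[of _ "\<lambda>s. nat (s + 3)" "\<lambda>m. int m - 3"])
    fix m assume m: "m \<in> {2..\<alpha>}"
    define s where "s = int m - 3"
    have "(\<Sum>j = s + 3..int \<alpha>. int (nat (j - 2) choose nat (s + 1)) * (- 1) ^ nat (j - s - 1) * int (g (nat j)))
        = (\<Sum>j=m..\<alpha>. int (j - 2 choose (m - 2)) * (- 1) ^ (j - m) * int (g j))"
    proof (rule sum.reindex_bij_witness[of _ int nat])
      fix j assume j: "j \<in> {s + 3..int \<alpha>}"
      \<comment> \<open>The exponents \<open>j - s - 1\<close> and \<open>j - m\<close> differ by two, so the signs agree.\<close>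
      have "nat (j - 2) = nat j - 2" "nat (s + 1) = m - 2" "nat (j - s - 1) = nat j - m + 2"
        using j m by (auto simp: s_def)
      then show "int (nat j - 2 choose (m - 2)) * (- 1) ^ (nat j - m) * int (g (nat j))
          = int (nat (j - 2) choose nat (s + 1)) * (- 1) ^ nat (j - s - 1) * int (g (nat j))"
        by simp
    qed (use m in \<open>auto simp: s_def\<close>)
    also have "\<dots> = (\<Sum>j=m..n. int (j - 2 choose (m - 2)) * (- 1) ^ (j - m) * int (g j))"
      using \<alpha>n g0 by (intro sum.mono_neutral_left) auto
    finally have "Ecoeff (s + 3) = c m"
      using assms(5)[of s] m by (simp add: c_def s_def)
    then show "monom (Ecoeff (int m - 3 + 3)) (nat (int n - (int m - 3) - 3)) = monom (c m) (n - m)"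
      using m \<alpha>n by (simp add: s_def nat_diff_distrib)
  qed auto
  finally show ?thesis .
qed

end
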